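(* Let $n$ be the number of players, let $0<\epsilon\le 1/e$ and $t\ge 1$ be real numbers, and let $P_r$ be any given set of $r$ players with $r\le \epsilon\, e^{\sqrt{\ln n}/7}$. There is a randomized algorithm in the Robertson–Webb query model which consists of two parts: (1) a preassigning part which assigns fair portions to all players in $P_r$ using $O\!\left(\frac{tr^2}{\epsilon}\left(\log\frac{r}{\epsilon}\right)^3\right)$ queries; and (2) a completion part which, using $O(rn\log(rn))$ queries, assigns fair portions of the remaining cake to all remaining players (those not in $P_r$) except for at most $\epsilon n$ of them (the "victims"). With probability at least $1-(\epsilon/r)^t\ge 1-e^{-t}$, all of these guarantees hold simultaneously (with pairwise disjoint portions).
   Context: Cake-cutting setting: $P$ is a set of $n$ players, and the algorithm knows $n$. The cake is the interval $C=[0,1]$. Each player $p$ has a nonnegative additive value function $\mu_p$ defined on measurable subsets of $C$, with $\mu_p(C)=1$. A portion is a set of disjoint subintervals of $C$; portions given to different players are disjoint. A portion $C_p$ is fair for $p$ if $\mu_p(C_p)\ge 1/n$. Players answer queries honestly. Robertson–Webb model: the algorithm accesses the value functions only via (i) cut queries $\mathrm{Cut}([a,b],p,\alpha)$, returning the smallest $x\in[a,b]$ with $\mu_p([a,x])=\alpha$ (or a special message if $\mu_p([a,b])<\alpha$), and (ii) evaluation queries $\mathrm{Eval}([a,b],p,x)$, returning $\mu_p([a,x])$; the running time is the number of queries. Here the preassigned set $P_r$ is designated in advance (given as input). *)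

theory Defs
  imports "HOL-Probability.Probability"
begin

section \<open>Cake and value functions\<close>

text \<open>
  Value functions are only assumed finitely additive. The last condition is the usual
  divisibility of the cake: it says exactly that every cut query with
  \<open>\<alpha> \<le> \<mu> [a, b]\<close> has an answer. It makes points worthless, and the smallest
  answer exists, see \<open>cut_answer_least\<close> below.
\<close>

definition value_function :: "(real set \<Rightarrow> real) \<Rightarrow> bool" where
  "value_function \<mu> \<longleftrightarrow>
     (\<forall>A \<in> sets (restrict_space borel {0..1}). 0 \<le> \<mu> A) \<and>
     additive (sets (restrict_space borel {0..1})) \<mu> \<and>
     \<mu> {0..1} = 1 \<and>
     (\<forall>a b \<alpha>. 0 \<le> a \<and> a \<le> b \<and> b \<le> 1 \<and> 0 \<le> \<alpha> \<and> \<alpha> \<le> \<mu> {a..b} \<longrightarrow>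
        (\<exists>x\<in>{a..b}. \<mu> {a..x} = \<alpha>))"

type_synonym portion = "real set set"

definition is_portion :: "portion \<Rightarrow> bool" where
  "is_portion S \<longleftrightarrow> finite S \<and> disjoint S \<and> (\<forall>I\<in>S. is_interval I \<and> I \<subseteq> {0..1})"

definition fair_portion :: "nat \<Rightarrow> (real set \<Rightarrow> real) \<Rightarrow> portion \<Rightarrow> bool" where
  "fair_portion n \<mu> S \<longleftrightarrow> is_portion S \<and> \<mu> (\<Union>S) \<ge> 1 / real n"


section \<open>Randomized algorithms in the Robertson--Webb query model\<close>

text \<open>
  An algorithm is a well-founded decision tree that sees the value functions only through
  the answers to its queries; \<open>Random\<close> draws from a discrete distribution and is not
  charged. Players are natural numbers.

  The special message of a cut query is \<^const>\<open>None\<close>. Malformed queries (an interval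
  that is not inside the cake, a negative \<open>\<alpha>\<close>, a point \<open>x\<close> outside \<open>[a, b]\<close>)
  receive an answer that carries no information.
\<close>

datatype 'a rw_algorithm =
    Return 'a
  | Cut real real nat real "real option \<Rightarrow> 'a rw_algorithm"
  | Eval real real nat real "real \<Rightarrow> 'a rw_algorithm"
  | Random "nat pmf" "nat \<Rightarrow> 'a rw_algorithm"

definition cut_answer :: "(real set \<Rightarrow> real) \<Rightarrow> real \<Rightarrow> real \<Rightarrow> real \<Rightarrow> real option" where
  "cut_answer \<mu> a b \<alpha> =
     (if 0 \<le> a \<and> a \<le> b \<and> b \<le> 1 \<and> 0 \<le> \<alpha> \<and> \<alpha> \<le> \<mu> {a..b}
      then Some (LEAST x. x \<in> {a..b} \<and> \<mu> {a..x} = \<alpha>) else None)"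

definition eval_answer :: "(real set \<Rightarrow> real) \<Rightarrow> real \<Rightarrow> real \<Rightarrow> real \<Rightarrow> real" where
  "eval_answer \<mu> a b x =
     (if 0 \<le> a \<and> a \<le> x \<and> x \<le> b \<and> b \<le> 1 then \<mu> {a..x} else 0)"

text \<open>The joint distribution of the output and the number of queries.\<close>

primrec run :: "(nat \<Rightarrow> real set \<Rightarrow> real) \<Rightarrow> 'a rw_algorithm \<Rightarrow> ('a \<times> nat) pmf" where
  "run \<mu> (Return y) = return_pmf (y, 0)"
| "run \<mu> (Cut a b p \<alpha> k) = map_pmf (apsnd Suc) (run \<mu> (k (cut_answer (\<mu> p) a b \<alpha>)))"
| "run \<mu> (Eval a b p x k) = map_pmf (apsnd Suc) (run \<mu> (k (eval_answer (\<mu> p) a b x)))"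
| "run \<mu> (Random D k) = bind_pmf D (\<lambda>i. run \<mu> (k i))"

text \<open>
  The preassigning part returns its assignment together with the completion part to be run
  next, so that the completion part may use everything learnt so far but can no longer
  change the preassigned portions.
\<close>

type_synonym assignment = "nat \<Rightarrow> portion"

type_synonym two_part_algorithm = "(assignment \<times> assignment rw_algorithm) rw_algorithm"

text \<open>
  The outcome \<open>(X, q, Y, q')\<close> consists of the assignment and the number of queries of the
  preassigning part, followed by those of the completion part.
\<close>

definition run_two_part ::
  "(nat \<Rightarrow> real set \<Rightarrow> real) \<Rightarrow> two_part_algorithm \<Rightarrow> (assignment \<times> nat \<times> assignment \<times> nat) pmf"
where
  "run_two_part \<mu> A =
     bind_pmf (run \<mu> A) (\<lambda>((X, B), q). map_pmf (\<lambda>(Y, q'). (X, q, Y, q')) (run \<mu> B))"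


section \<open>The guarantees, for players \<open>{..<n}\<close> and preassigned players \<open>R\<close>\<close>

definition preassigned_fairly ::
  "nat \<Rightarrow> nat set \<Rightarrow> (nat \<Rightarrow> real set \<Rightarrow> real) \<Rightarrow> assignment \<Rightarrow> bool" where
  "preassigned_fairly n R \<mu> X \<longleftrightarrow> (\<forall>p\<in>R. fair_portion n (\<mu> p) (X p))"

text \<open>\<open>V\<close> is the set of victims; they may get any portion, in particular the empty one.\<close>

definition completed_fairly ::
  "nat \<Rightarrow> nat set \<Rightarrow> real \<Rightarrow> (nat \<Rightarrow> real set \<Rightarrow> real) \<Rightarrow> assignment \<Rightarrow> bool" where
  "completed_fairly n R \<epsilon> \<mu> Y \<longleftrightarrow>
     (\<exists>V \<subseteq> {..<n} - R. real (card V) \<le> \<epsilon> * real n \<and>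
        (\<forall>p \<in> {..<n} - R - V. fair_portion n (\<mu> p) (Y p)))"

definition disjoint_portions :: "nat \<Rightarrow> nat set \<Rightarrow> assignment \<Rightarrow> assignment \<Rightarrow> bool" where
  "disjoint_portions n R X Y \<longleftrightarrow>
     disjoint_family_on (\<lambda>p. \<Union>(if p \<in> R then X p else Y p)) {..<n}"


section \<open>Cut queries are well defined\<close>

lemma interval_in_cake:
  assumes "0 \<le> (a::real)" "b \<le> 1"
  shows "{a..b} \<in> sets (restrict_space borel {0..1})"
    and "{a<..b} \<in> sets (restrict_space borel {0..1})"
  using assms by (auto simp: sets_restrict_space_iff)

lemma value_split:
  assumes "value_function \<mu>" "0 \<le> a" "a \<le> x" "x \<le> b" "b \<le> 1"
  shows "\<mu> {a..b} = \<mu> {a..x} + \<mu> {x<..b}" and "0 \<le> \<mu> {x<..b}"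
proof -
  have "{a..b} = {a..x} \<union> {x<..b}" "{a..x} \<inter> {x<..b} = {}"
    using assms by auto
  then show "\<mu> {a..b} = \<mu> {a..x} + \<mu> {x<..b}"
    using assms interval_in_cake[of a x] interval_in_cake[of x b]
    unfolding value_function_def additive_def by auto
  show "0 \<le> \<mu> {x<..b}"
    using assms interval_in_cake[of x b] unfolding value_function_def by auto
qed

lemma cut_answer_least:
  assumes \<mu>: "value_function \<mu>"
    and ab: "0 \<le> a" "a \<le> b" "b \<le> 1" "0 \<le> \<alpha>" "\<alpha> \<le> \<mu> {a..b}"
  obtains x where "cut_answer \<mu> a b \<alpha> = Some x" "x \<in> {a..b}" "\<mu> {a..x} = \<alpha>"
    "\<And>y. y \<in> {a..b} \<Longrightarrow> \<mu> {a..y} = \<alpha> \<Longrightarrow> x \<le> y"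
proof -
  define S where "S = {x \<in> {a..b}. \<mu> {a..x} = \<alpha>}"
  have div: "\<exists>x\<in>{a..c}. \<mu> {a..x} = \<beta>" if "a \<le> c" "c \<le> 1" "0 \<le> \<beta>" "\<beta> \<le> \<mu> {a..c}" for c \<beta>
    using \<mu> that ab(1) unfolding value_function_def by blast
  have mono: "\<mu> {a..x} \<le> \<mu> {a..y}" if "a \<le> x" "x \<le> y" "y \<le> b" for x y
    using value_split[OF \<mu>, of a x y] that ab by simp
  have ne: "S \<noteq> {}" using div[of b \<alpha>] ab unfolding S_def by auto
  have bdd: "bdd_below S" unfolding S_def by (auto intro: bdd_belowI[of _ a])
  define m where "m = Inf S"
  have lb: "m \<le> y" if "y \<in> S" for y
    unfolding m_def using that bdd by (rule cInf_lower)
  have am: "a \<le> m" unfolding m_def by (rule cInf_greatest[OF ne]) (auto simp: S_def)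
  obtain s where s: "s \<in> S" using ne by blast
  have mb: "m \<le> b" using lb[OF s] s unfolding S_def by auto
  have le: "\<mu> {a..m} \<le> \<alpha>" using mono[of m s] lb[OF s] am s unfolding S_def by auto
  have ge: "\<mu> {a..m} \<ge> \<alpha>"
  proof (rule ccontr)
    assume "\<not> ?thesis"
    then have lt: "\<mu> {a..m} < \<alpha>" by simp
    have nn: "0 \<le> \<mu> {a..m}"
      using \<mu> interval_in_cake(1)[of a m] ab mb unfolding value_function_def by auto
    obtain z where z: "z \<in> {a..s}" "\<mu> {a..z} = (\<mu> {a..m} + \<alpha>) / 2"
      using div[of s "(\<mu> {a..m} + \<alpha>) / 2"] s lt nn ab unfolding S_def by auto
    have "m < z"
    proof (rule ccontr)
      assume "\<not> m < z"
      then have "\<mu> {a..z} \<le> \<mu> {a..m}" using mono[of z m] z mb by auto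
      then show False using z lt by simp
    qed
    then obtain y where y: "y \<in> S" "y < z" unfolding m_def using cInf_lessD[OF ne] by blast
    then have "\<mu> {a..y} \<le> \<mu> {a..z}" using mono[of y z] z s unfolding S_def by auto
    then show False using y z lt unfolding S_def by auto
  qed
  have mS: "m \<in> S" using le ge am mb unfolding S_def by auto
  have "(LEAST x. x \<in> {a..b} \<and> \<mu> {a..x} = \<alpha>) = m"
    by (rule Least_equality) (use mS lb in \<open>auto simp: S_def\<close>)
  then have "cut_answer \<mu> a b \<alpha> = Some m" using ab unfolding cut_answer_def by simp
  then show thesis using that[of m] mS lb unfolding S_def by auto
qed

end

theory Submission
  imports Defs
begin

text \<open>
  Each player of \<open>R\<close> takes her portion inside a gap of the remaining cake, repeatedly halving it
  and keeping a half that a random sample of players does not care for. Sampled players are drawn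
  from an even mixture of the uniform distributions on all players and on \<open>R\<close>, which protects the
  few players of \<open>R\<close> as well as the crowd. Progress is measured by the mean of the
  truncated value \<open>min (\<mu> q I / \<tau>) 1\<close>: when \<open>\<tau>\<close> shrinks by the factor \<open>3/4\<close> at every halving, this
  mean hardly grows, because only players with value at most \<open>\<tau>\<close> take part in the vote, and a half
  holding too much of their value loses it by an exponential moment bound. After
  \<open>O(ln (r / \<epsilon>))\<close> halvings all but few players value the portion at most \<open>\<epsilon> / (4 r)\<close>, while it is
  still worth at least \<open>1 / n\<close> to its owner. Giving up \<open>\<lfloor>\<epsilon> n\<rfloor>\<close> victims then leaves players whose
  share of the remaining cake is large enough for the Even--Paz algorithm.
\<close>

section \<open>Composing algorithms\<close>

text \<open>The obstacle is that a sampled vote cannot recognise the better half exactly. It only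
  rules out a half holding more than three quarters of the light players' value, and only if that
  amount exceeds a floor \<eta>. The factor 3/4 is matched to this: 4/3 times 3/4 is 1, so a halving
  raises the mean by at most 4/3 * \<eta>. The owner loses a factor 2 each time, so the number k of
  halvings must be paid for by n. With L = ln (r / \<epsilon>), the bound on r says 7 * L \<le> sqrt
  (ln n), hence n \<ge> exp (49 * L), while k \<le> 33 * L. The final mean is used twice. A member
  of R has probability at least 1 / (2 * r) in the mixture, more than the mean of one portion
  allows, so no member of R values any preassigned portion above the last truncation level, and the
  members still waiting find a valuable gap by pigeonhole. Everybody has probability at least 1 / (2
  * n), so few of the others can have lost much. Truncation is subadditive, so the means of the r
  portions add up to a bound for the truncated total loss.\<close>

primrec rw_bind :: "'a rw_algorithm \<Rightarrow> ('a \<Rightarrow> 'b rw_algorithm) \<Rightarrow> 'b rw_algorithm" where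
  "rw_bind (Return y) f = f y"
| "rw_bind (Cut a b p \<alpha> k) f = Cut a b p \<alpha> (\<lambda>x. rw_bind (k x) f)"
| "rw_bind (Eval a b p x k) f = Eval a b p x (\<lambda>v. rw_bind (k v) f)"
| "rw_bind (Random D k) f = Random D (\<lambda>i. rw_bind (k i) f)"

lemma run_rw_bind:
  fixes f :: "'a \<Rightarrow> 'b rw_algorithm"
  shows "run \<mu> (rw_bind A f) =
     bind_pmf (run \<mu> A) (\<lambda>(y, q). map_pmf (apsnd ((+) q)) (run \<mu> (f y)))"
proof (induction A)
  case (Return y)
  have "apsnd ((+) (0::nat)) = (id :: 'b \<times> nat \<Rightarrow> _)" by (auto simp: fun_eq_iff)
  then show ?case by (simp add: bind_return_pmf)
next
  case (Cut a b p \<alpha> k)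
  have "apsnd Suc \<circ> apsnd ((+) q) = (apsnd ((+) (Suc q)) :: 'b \<times> nat \<Rightarrow> _)" for q
    by (auto simp: fun_eq_iff)
  then show ?case
    by (simp add: Cut map_bind_pmf bind_map_pmf pmf.map_comp case_prod_beta)
next
  case (Eval a b p x k)
  have "apsnd Suc \<circ> apsnd ((+) q) = (apsnd ((+) (Suc q)) :: 'b \<times> nat \<Rightarrow> _)" for q
    by (auto simp: fun_eq_iff)
  then show ?case
    by (simp add: Eval map_bind_pmf bind_map_pmf pmf.map_comp case_prod_beta)
next
  case (Random D k)
  then show ?case by (simp add: bind_assoc_pmf)
qed

text \<open>A query overrun counts as failure just like a bad result, so budgets and error
  probabilities compose together. The case \<delta> = 0 is almost sure success and serves the parts
  that draw nothing.\<close>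

definition achieves ::
  "(nat \<Rightarrow> real set \<Rightarrow> real) \<Rightarrow> 'a rw_algorithm \<Rightarrow> nat \<Rightarrow> real \<Rightarrow> ('a \<Rightarrow> bool) \<Rightarrow> bool" where
  "achieves \<mu> A c \<delta> P \<longleftrightarrow> measure_pmf.prob (run \<mu> A) {(y, q). \<not> (P y \<and> q \<le> c)} \<le> \<delta>"

lemma prob_bind_pmf:
  "measure_pmf.prob (bind_pmf M K) S = measure_pmf.expectation M (\<lambda>x. measure_pmf.prob (K x) S)"
proof -
  have "ennreal (measure_pmf.prob (bind_pmf M K) S) = 
      ennreal (measure_pmf.expectation M (\<lambda>x. measure_pmf.prob (K x) S))"
    unfolding measure_pmf.emeasure_eq_measure[symmetric] emeasure_bind_pmf
    by (simp add: measure_pmf.emeasure_eq_measure nn_integral_eq_integral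
        measure_pmf.integrable_const_bound[where B=1])
  then show ?thesis by (subst (asm) ennreal_inj) (auto intro!: integral_nonneg)
qed

lemma achieves_weaken:
  assumes "achieves \<mu> A c \<delta> P" "c \<le> c'" "\<delta> \<le> \<delta>'" "\<And>y. P y \<Longrightarrow> P' y"
  shows "achieves \<mu> A c' \<delta>' P'"
  unfolding achieves_def
proof (rule order.trans)
  show "measure_pmf.prob (run \<mu> A) {(y, q). \<not> (P' y \<and> q \<le> c')}
      \<le> measure_pmf.prob (run \<mu> A) {(y, q). \<not> (P y \<and> q \<le> c)}"
    using assms(2,4) by (intro measure_pmf.finite_measure_mono) (auto intro: order.trans)
qed (use assms in \<open>auto simp: achieves_def\<close>)

lemma achieves_trivial: "1 \<le> \<delta> \<Longrightarrow> achieves \<mu> A c \<delta> P"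
  unfolding achieves_def by (rule order.trans[OF measure_pmf.prob_le_1])

lemma achieves_Return: "P y \<Longrightarrow> 0 \<le> \<delta> \<Longrightarrow> achieves \<mu> (Return y) c \<delta> P"
  by (simp add: achieves_def measure_return_pmf)

lemma achieves_map_Suc:
  "measure_pmf.prob (map_pmf (apsnd Suc) M) {(y, q). \<not> (P y \<and> q \<le> Suc c)}
     = measure_pmf.prob M {(y, q). \<not> (P y \<and> q \<le> c)}"
  by (simp add: vimage_def case_prod_unfold)

lemma achieves_Cut:
  "achieves \<mu> (Cut a b p \<alpha> k) (Suc c) \<delta> P
    \<longleftrightarrow> achieves \<mu> (k (cut_answer (\<mu> p) a b \<alpha>)) c \<delta> P"
  by (simp only: achieves_def run.simps achieves_map_Suc)

lemma achieves_Eval: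
  "achieves \<mu> (Eval a b p x k) (Suc c) \<delta> P
    \<longleftrightarrow> achieves \<mu> (k (eval_answer (\<mu> p) a b x)) c \<delta> P"
  by (simp only: achieves_def run.simps achieves_map_Suc)

text \<open>A union bound: outside \<open>G\<close> the second stage is charged the full probability
  1, which \<delta> pays for.\<close>

lemma prob_bind_pmf_le:
  assumes "measure_pmf.prob M {x. \<not> G x} \<le> \<delta>" "0 \<le> \<delta>'"
    and "\<And>x. G x \<Longrightarrow> measure_pmf.prob (K x) S \<le> \<delta>'"
  shows "measure_pmf.prob (bind_pmf M K) S \<le> \<delta> + \<delta>'"
proof -
  have int: "integrable M (indicator {x. \<not> G x} :: _ \<Rightarrow> real)"
    by (auto intro: integrable_real_indicator simp: measure_pmf.emeasure_eq_measure)
  have "measure_pmf.prob (bind_pmf M K) S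
      \<le> measure_pmf.expectation M (\<lambda>x. indicator {x. \<not> G x} x + \<delta>')"
    unfolding prob_bind_pmf
  proof (rule integral_mono)
    show "integrable M (\<lambda>x. measure_pmf.prob (K x) S)"
      by (rule measure_pmf.integrable_const_bound[where B=1]) auto
    show "integrable M (\<lambda>x. indicator {x. \<not> G x} x + \<delta>' :: real)"
      by (rule Bochner_Integration.integrable_add[OF int]) simp
    show "measure_pmf.prob (K x) S \<le> indicator {x. \<not> G x} x + \<delta>'" for x
    proof (cases "G x")
      case True then show ?thesis using assms(3) by simp
    next
      case False
      then have "indicator {x. \<not> G x} x + \<delta>' = 1 + \<delta>'" by simp
      then show ?thesis using assms(2) measure_pmf.prob_le_1[of "K x" S] by linarith
    qed
  qed
  also have "\<dots> = measure_pmf.prob M {x. \<not> G x} + \<delta>'"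
    by (subst Bochner_Integration.integral_add[OF int]) simp_all
  finally show ?thesis using assms(1) by simp
qed

lemma achieves_bind:
  assumes A: "achieves \<mu> A c \<delta> P" and f: "\<And>y. P y \<Longrightarrow> achieves \<mu> (f y) c' \<delta>' Q"
    and "0 \<le> \<delta>'"
  shows "achieves \<mu> (rw_bind A f) (c + c') (\<delta> + \<delta>') Q"
  unfolding achieves_def run_rw_bind
proof (rule prob_bind_pmf_le)
  show "measure_pmf.prob (run \<mu> A) {x. \<not> (case x of (y, q) \<Rightarrow> P y \<and> q \<le> c)} \<le> \<delta>"
    using A by (simp add: achieves_def case_prod_unfold)
  fix x assume x: "case x of (y, q) \<Rightarrow> P y \<and> q \<le> c"
  obtain y q where yq: "x = (y, q)" "P y" "q \<le> c" using x by auto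
  have "measure_pmf.prob (run \<mu> (f y)) (apsnd ((+) q) -` {(y, q). \<not> (Q y \<and> q \<le> c + c')})
      \<le> measure_pmf.prob (run \<mu> (f y)) {(y, q). \<not> (Q y \<and> q \<le> c')}"
    using yq by (intro measure_pmf.finite_measure_mono) auto
  also have "\<dots> \<le> \<delta>'" using f yq by (auto simp: achieves_def)
  finally show "measure_pmf.prob (case x of (y, q) \<Rightarrow> map_pmf (apsnd ((+) q)) (run \<mu> (f y)))
      {(y, q). \<not> (Q y \<and> q \<le> c + c')} \<le> \<delta>'"
    using yq by simp
qed (fact assms)

lemma achieves_bind0:
  assumes "achieves \<mu> A c 0 P" "\<And>y. P y \<Longrightarrow> achieves \<mu> (f y) c' \<delta> Q" "0 \<le> \<delta>"
  shows "achieves \<mu> (rw_bind A f) (c + c') \<delta> Q"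
  using achieves_bind[OF assms] by simp

section \<open>Values of intervals and of lists of gaps\<close>

context
  fixes \<mu> :: "real set \<Rightarrow> real"
  assumes vf: "value_function \<mu>"
begin

text \<open>Divisibility of the degenerate interval at \<alpha> = 0 leaves only the point itself as
  an answer.\<close>

lemma value_point: "0 \<le> a \<Longrightarrow> a \<le> 1 \<Longrightarrow> \<mu> {a} = 0"
proof -
  assume a: "0 \<le> a" "a \<le> 1"
  have nn: "0 \<le> \<mu> {a}"
    using vf interval_in_cake(1)[of a a] a unfolding value_function_def by auto
  have *: "\<exists>x\<in>{a..b}. \<mu> {a..x} = \<alpha>" if "0 \<le> a" "a \<le> b" "b \<le> 1" "0 \<le> \<alpha>" "\<alpha> \<le> \<mu> {a..b}" for a b \<alpha>
    using vf that unfolding value_function_def by blast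
  have "\<exists>x\<in>{a..a}. \<mu> {a..x} = 0"
    using *[of a a 0] a nn by simp
  then show ?thesis by auto
qed

lemma value_half_open: "0 \<le> a \<Longrightarrow> a \<le> b \<Longrightarrow> b \<le> 1 \<Longrightarrow> \<mu> {a<..b} = \<mu> {a..b}"
  using value_split(1)[OF vf, of a a b] value_point[of a] by simp

lemma value_split_closed:
  "0 \<le> a \<Longrightarrow> a \<le> x \<Longrightarrow> x \<le> b \<Longrightarrow> b \<le> 1 \<Longrightarrow> \<mu> {a..b} = \<mu> {a..x} + \<mu> {x..b}"
  using value_split(1)[OF vf, of a x b] value_half_open[of x b] by simp

lemma value_nonneg: "0 \<le> a \<Longrightarrow> b \<le> 1 \<Longrightarrow> 0 \<le> \<mu> {a..b}"
  using vf interval_in_cake(1)[of a b] unfolding value_function_def by auto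

lemma value_mono: "0 \<le> a \<Longrightarrow> a \<le> c \<Longrightarrow> c \<le> d \<Longrightarrow> d \<le> b \<Longrightarrow> b \<le> 1 \<Longrightarrow> \<mu> {c..d} \<le> \<mu> {a..b}"
  using value_split_closed[of a c b] value_split_closed[of c d b] value_nonneg[of a c]
    value_nonneg[of d b] by simp

lemma value_le_1: "0 \<le> a \<Longrightarrow> a \<le> b \<Longrightarrow> b \<le> 1 \<Longrightarrow> \<mu> {a..b} \<le> 1"
  using value_mono[of 0 a b 1] vf unfolding value_function_def by auto

end

text \<open>
  The part of the cake that is still available is the union of the intervals \<open>{a<..b}\<close>
  over the pairs \<open>(a, b)\<close> of a list.
\<close>

primrec gaps :: "real \<Rightarrow> (real \<times> real) list \<Rightarrow> bool" where
  "gaps x [] \<longleftrightarrow> x \<le> 1"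
| "gaps x (I # gs) \<longleftrightarrow> x \<le> fst I \<and> fst I \<le> snd I \<and> gaps (snd I) gs"

definition pieces :: "(real \<times> real) list \<Rightarrow> portion" where
  "pieces gs = (\<lambda>(a, b). {a<..b}) ` set gs"

text \<open>Closed intervals are what queries measure, whereas \<open>pieces\<close> are half-open
  in order to be disjoint; worthless points reconcile the two.\<close>

definition worth :: "(real set \<Rightarrow> real) \<Rightarrow> (real \<times> real) list \<Rightarrow> real" where
  "worth \<mu> gs = (\<Sum>(a, b)\<leftarrow>gs. \<mu> {a..b})"

lemma worth_simps [simp]:
  "worth \<mu> [] = 0" "worth \<mu> ((a, b) # gs) = \<mu> {a..b} + worth \<mu> gs"
  by (simp_all add: worth_def)

lemma pieces_simps [simp]:
  "pieces [] = {}" "pieces ((a, b) # gs) = insert {a<..b} (pieces gs)"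
  by (simp_all add: pieces_def)

lemma gaps_le_1: "gaps x gs \<Longrightarrow> x \<le> 1"
  by (induction gs arbitrary: x) force+

lemma gaps_mono: "gaps x gs \<Longrightarrow> y \<le> x \<Longrightarrow> gaps y gs"
  by (cases gs) auto

lemma Union_pieces_subset: "gaps x gs \<Longrightarrow> \<Union>(pieces gs) \<subseteq> {x<..1}"
proof (induction gs arbitrary: x)
  case (Cons I gs)
  then show ?case using gaps_le_1[of "snd I" gs] by (cases I) (fastforce)
qed simp

lemma is_portion_pieces:
  assumes "gaps x gs" "0 \<le> x" shows "is_portion (pieces gs)"
  using assms
proof (induction gs arbitrary: x)
  case Nil then show ?case by (simp add: is_portion_def)
next
  case (Cons I gs)
  obtain a b where I: "I = (a, b)" by (cases I)
  have ab: "0 \<le> a" "a \<le> b" "b \<le> 1" "gaps b gs" using Cons.prems gaps_le_1[of b gs] I by auto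
  have IH: "is_portion (pieces gs)" using Cons.IH[of b] ab by auto
  have "\<Union>(pieces gs) \<subseteq> {b<..1}" using Union_pieces_subset ab by blast
  then have "{a<..b} \<inter> J = {}" if "J \<in> pieces gs" for J using that by fastforce
  then show ?case using IH ab I
    by (auto simp: is_portion_def pairwise_insert disjnt_def is_interval_oc)
qed

text \<open>Measurability is carried along in the induction because additivity speaks of measurable
  sets only.\<close>

lemma worth_pieces:
  assumes vf: "value_function \<mu>" and "gaps x gs" "0 \<le> x"
  shows "\<Union>(pieces gs) \<in> sets (restrict_space borel {0..1}) \<and> \<mu> (\<Union>(pieces gs)) = worth \<mu> gs"
  using assms(2,3)
proof (induction gs arbitrary: x)
  case Nil
  have ad: "additive (sets (restrict_space borel {0..1})) \<mu>" using vf by (simp add: value_function_def)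
  \<comment> \<open>Additivity alone has to yield that the empty set is worthless.\<close>
  have "\<mu> ({} \<union> {}) = \<mu> {} + \<mu> {}"
    using ad sets.empty_sets unfolding additive_def by blast
  then show ?case by simp
next
  case (Cons I gs)
  obtain a b where I: "I = (a, b)" by (cases I)
  have ab: "0 \<le> a" "a \<le> b" "b \<le> 1" "gaps b gs" using Cons.prems gaps_le_1[of b gs] I by auto
  have IH: "\<Union>(pieces gs) \<in> sets (restrict_space borel {0..1})" "\<mu> (\<Union>(pieces gs)) = worth \<mu> gs"
    using Cons.IH[of b] ab by auto
  have "\<Union>(pieces gs) \<subseteq> {b<..1}" using Union_pieces_subset ab by blast
  then have "{a<..b} \<inter> \<Union>(pieces gs) = {}" by fastforce
  moreover have "{a<..b} \<in> sets (restrict_space borel {0..1})" using interval_in_cake ab by auto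
  moreover have "additive (sets (restrict_space borel {0..1})) \<mu>"
    using vf by (simp add: value_function_def)
  ultimately have "\<mu> ({a<..b} \<union> \<Union>(pieces gs)) = \<mu> {a<..b} + \<mu> (\<Union>(pieces gs))"
    "{a<..b} \<union> \<Union>(pieces gs) \<in> sets (restrict_space borel {0..1})"
    using IH unfolding additive_def by blast+
  then show ?case using IH ab I value_half_open[OF vf] by auto
qed

lemma eval_answer_whole:
  "0 \<le> a \<Longrightarrow> a \<le> b \<Longrightarrow> b \<le> 1 \<Longrightarrow> eval_answer \<mu> a b b = \<mu> {a..b}"
  by (simp add: eval_answer_def)

section \<open>Dividing a list of gaps\<close>

primrec appraise :: "nat \<Rightarrow> (real \<times> real) list \<Rightarrow> real rw_algorithm" where
  "appraise q [] = Return 0"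
| "appraise q (I # gs) = Eval (fst I) (snd I) q (snd I)
     (\<lambda>v. rw_bind (appraise q gs) (\<lambda>w. Return (v + w)))"

lemma achieves_appraise:
  "gaps x gs \<Longrightarrow> 0 \<le> x \<Longrightarrow> achieves \<mu> (appraise q gs) (length gs) 0 (\<lambda>w. w = worth (\<mu> q) gs)"
proof (induction gs arbitrary: x)
  case (Cons I gs)
  obtain a b where I: "I = (a, b)" by (cases I)
  have ab: "0 \<le> a" "a \<le> b" "b \<le> 1" "gaps b gs" using Cons.prems gaps_le_1[of b gs] I by auto
  have "achieves \<mu> (rw_bind (appraise q gs) (\<lambda>w. Return (\<mu> q {a..b} + w))) (length gs + 0) 0
      (\<lambda>w. w = worth (\<mu> q) (I # gs))"
    by (rule achieves_bind0[OF Cons.IH[of b]])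
      (use ab I in \<open>auto intro!: achieves_Return\<close>)
  then show ?case using ab I by (simp add: achieves_Eval eval_answer_whole)
qed (simp add: achieves_Return)

primrec contented :: "(real \<times> real) list \<Rightarrow> real \<Rightarrow> nat list \<Rightarrow> nat list rw_algorithm" where
  "contented gs \<theta> [] = Return []"
| "contented gs \<theta> (q # qs) = rw_bind (appraise q gs) (\<lambda>w. rw_bind (contented gs \<theta> qs)
     (\<lambda>ps. Return (if \<theta> \<le> w then q # ps else ps)))"

lemma achieves_contented:
  assumes "gaps 0 gs"
  shows "achieves \<mu> (contented gs \<theta> qs) (length qs * length gs) 0
           (\<lambda>ps. ps = filter (\<lambda>q. \<theta> \<le> worth (\<mu> q) gs) qs)"
proof (induction qs)
  case (Cons q qs)
  have "achieves \<mu> (contented gs \<theta> (q # qs)) (length gs + (length qs * length gs + 0)) 0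
           (\<lambda>ps. ps = filter (\<lambda>q. \<theta> \<le> worth (\<mu> q) gs) (q # qs))"
    unfolding contented.simps
    by (rule achieves_bind0[OF achieves_appraise[OF assms order.refl]] achieves_bind0[OF Cons])+
      (auto intro!: achieves_Return)
  then show ?case by simp
qed (simp add: achieves_Return)

text \<open>Endpoints are clamped instead of gaps being dropped. The length of the list, which
  determines the query counts, is thus preserved, at the price of degenerate gaps that are empty and
  worthless.\<close>

definition left_of :: "real \<Rightarrow> (real \<times> real) list \<Rightarrow> (real \<times> real) list" where
  "left_of x = map (\<lambda>(a, b). (min a x, min b x))"

definition right_of :: "real \<Rightarrow> (real \<times> real) list \<Rightarrow> (real \<times> real) list" where
  "right_of x = map (\<lambda>(a, b). (max a x, max b x))"

lemma left_right_simps [simp]: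
  "left_of x [] = []" "left_of x ((a, b) # gs) = (min a x, min b x) # left_of x gs"
  "right_of x [] = []" "right_of x ((a, b) # gs) = (max a x, max b x) # right_of x gs"
  "length (left_of x gs) = length gs" "length (right_of x gs) = length gs"
  by (simp_all add: left_of_def right_of_def)

lemma gaps_left_of: "gaps y gs \<Longrightarrow> x \<le> 1 \<Longrightarrow> gaps (min y x) (left_of x gs)"
proof (induction gs arbitrary: y)
  case (Cons I gs)
  then show ?case using Cons.IH[of "snd I"] by (cases I) auto
qed auto

lemma gaps_right_of: "gaps y gs \<Longrightarrow> x \<le> 1 \<Longrightarrow> gaps (max y x) (right_of x gs)"
proof (induction gs arbitrary: y)
  case (Cons I gs)
  then show ?case using Cons.IH[of "snd I"] by (cases I) auto
qed auto

lemma Union_left_of: "\<Union>(pieces (left_of x gs)) = \<Union>(pieces gs) \<inter> {..x}"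
proof (induction gs)
  case (Cons I gs)
  obtain a b where "I = (a, b)" by (cases I)
  moreover have "{min a x<..min b x} = {a<..b} \<inter> {..x}" by auto
  ultimately show ?case using Cons by (simp add: Int_Un_distrib2)
qed simp

lemma Union_right_of: "\<Union>(pieces (right_of x gs)) = \<Union>(pieces gs) \<inter> {x<..}"
proof (induction gs)
  case (Cons I gs)
  obtain a b where "I = (a, b)" by (cases I)
  moreover have "{max a x<..max b x} = {a<..b} \<inter> {x<..}" by auto
  ultimately show ?case using Cons by (simp add: Int_Un_distrib2)
qed simp

lemma worth_left_right:
  assumes vf: "value_function \<mu>"
  shows "gaps y gs \<Longrightarrow> 0 \<le> y \<Longrightarrow> 0 \<le> x \<Longrightarrow> x \<le> 1 \<Longrightarrow>
    worth \<mu> (left_of x gs) + worth \<mu> (right_of x gs) = worth \<mu> gs"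
proof (induction gs arbitrary: y)
  case (Cons I gs)
  obtain a b where I: "I = (a, b)" by (cases I)
  have ab: "0 \<le> a" "a \<le> b" "b \<le> 1" "gaps b gs" using Cons.prems gaps_le_1[of b gs] I by auto
  consider "x \<le> a" | "a \<le> x" "x \<le> b" | "b \<le> x" by linarith
  then have "\<mu> {min a x..min b x} + \<mu> {max a x..max b x} = \<mu> {a..b}"
    using value_point[OF vf, of x] value_split_closed[OF vf, of a x b] Cons.prems(3,4) ab
    by cases (auto simp: min_def max_def)
  then show ?case using Cons.IH[of b] Cons.prems ab I by auto
qed simp

lemma worth_left_mono:
  assumes vf: "value_function \<mu>"
  shows "gaps z gs \<Longrightarrow> 0 \<le> z \<Longrightarrow> 0 \<le> x \<Longrightarrow> x \<le> y \<Longrightarrow> y \<le> 1 \<Longrightarrow>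
    worth \<mu> (left_of x gs) \<le> worth \<mu> (left_of y gs)"
proof (induction gs arbitrary: z)
  case (Cons I gs)
  obtain a b where I: "I = (a, b)" by (cases I)
  have ab: "0 \<le> a" "a \<le> b" "b \<le> 1" "gaps b gs" using Cons.prems gaps_le_1[of b gs] I by auto
  have "\<mu> {min a x..min b x} \<le> \<mu> {min a y..min b y}"
  proof (cases "x \<le> a")
    case True
    then have "min a x = x" "min b x = x" using ab by auto
    then show ?thesis using value_point[OF vf, of x] value_nonneg[OF vf, of "min a y" "min b y"]
        Cons.prems ab by simp
  next
    case False
    then show ?thesis using value_mono[OF vf, of a a "min b x" "min b y"] Cons.prems ab
      by (auto simp: min_def)
  qed
  then show ?case using Cons.IH[of b] Cons.prems ab I by (simp add: add_mono)
qed simp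

lemma worth_left_of_below:
  assumes vf: "value_function \<mu>"
  shows "gaps y gs \<Longrightarrow> 0 \<le> x \<Longrightarrow> x \<le> y \<Longrightarrow> worth \<mu> (left_of x gs) = 0"
proof (induction gs arbitrary: y)
  case (Cons I gs)
  obtain a b where I: "I = (a, b)" by (cases I)
  have ab: "x \<le> a" "a \<le> b" "b \<le> 1" "gaps b gs" using Cons.prems gaps_le_1[of b gs] I by auto
  then have "min a x = x" "min b x = x" by auto
  then show ?case using value_point[OF vf, of x] ab Cons.prems(2) Cons.IH[of b] I by simp
qed simp

section \<open>Marking a prescribed value in a list of gaps\<close>

primrec mark :: "nat \<Rightarrow> (real \<times> real) list \<Rightarrow> real \<Rightarrow> real rw_algorithm" where
  "mark q [] \<alpha> = Return 0"
| "mark q (I # gs) \<alpha> = Eval (fst I) (snd I) q (snd I)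
     (\<lambda>v. if v < \<alpha> then mark q gs (\<alpha> - v) else Cut (fst I) (snd I) q \<alpha> (\<lambda>x. Return (the x)))"

text \<open>The bound \<open>y \<le> x\<close> carries the induction: a gap that is passed over lies
  to the left of the mark, so clamping leaves it whole. The queries are at most one evaluation per
  gap and a single cut.\<close>

lemma achieves_mark:
  assumes vf: "value_function (\<mu> q)"
  shows "gaps y gs \<Longrightarrow> 0 \<le> y \<Longrightarrow> gs \<noteq> [] \<Longrightarrow> 0 \<le> \<alpha> \<Longrightarrow> \<alpha> \<le> worth (\<mu> q) gs \<Longrightarrow>
    achieves \<mu> (mark q gs \<alpha>) (Suc (length gs)) 0
      (\<lambda>x. y \<le> x \<and> x \<le> 1 \<and> worth (\<mu> q) (left_of x gs) = \<alpha>)"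
proof (induction gs arbitrary: y \<alpha>)
  case (Cons I gs)
  obtain a b where I: "I = (a, b)" by (cases I)
  have ab: "0 \<le> a" "a \<le> b" "b \<le> 1" "gaps b gs" using Cons.prems gaps_le_1[of b gs] I by auto
  show ?case
  proof (cases "\<mu> q {a..b} < \<alpha>")
    case True
    then have "gs \<noteq> []" using Cons.prems I by auto
    then have "achieves \<mu> (mark q gs (\<alpha> - \<mu> q {a..b})) (Suc (length gs)) 0
      (\<lambda>x. b \<le> x \<and> x \<le> 1 \<and> worth (\<mu> q) (left_of x gs) = \<alpha> - \<mu> q {a..b})"
      using Cons.IH[of b "\<alpha> - \<mu> q {a..b}"] Cons.prems True ab I by auto
    then show ?thesis using True I ab Cons.prems
      by (auto simp: achieves_Eval eval_answer_whole min_def elim!: achieves_weaken)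
  next
    case False
    obtain x where x: "cut_answer (\<mu> q) a b \<alpha> = Some x" "x \<in> {a..b}" "\<mu> q {a..x} = \<alpha>"
      using cut_answer_least[OF vf, of a b \<alpha>] ab False Cons.prems(4) by auto
    have "worth (\<mu> q) (left_of x gs) = 0"
      using worth_left_of_below[OF vf ab(4), of x] x ab by auto
    then show ?thesis using False I ab x Cons.prems
      by (auto simp: achieves_Eval achieves_Cut eval_answer_whole min_def intro!: achieves_Return)
  qed
qed simp

primrec marks :: "(real \<times> real) list \<Rightarrow> real \<Rightarrow> nat list \<Rightarrow> (nat \<Rightarrow> real) rw_algorithm" where
  "marks gs \<alpha> [] = Return (\<lambda>_. 0)"
| "marks gs \<alpha> (q # qs) = rw_bind (mark q gs \<alpha>) (\<lambda>x. rw_bind (marks gs \<alpha> qs)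
     (\<lambda>m. Return (m(q := x))))"

text \<open>The bounds hold for all players, not just the marked ones: in \<open>even_paz\<close>
  the entry \<open>ps ! h\<close> is unspecified when \<open>qs\<close> is empty, and the cut must
  lie in the cake even then.\<close>

lemma achieves_marks:
  assumes "gaps 0 gs" "gs \<noteq> []" "0 \<le> \<alpha>"
    and "\<And>q. q \<in> set qs \<Longrightarrow> value_function (\<mu> q) \<and> \<alpha> \<le> worth (\<mu> q) gs"
  shows "achieves \<mu> (marks gs \<alpha> qs) (length qs * Suc (length gs)) 0
      (\<lambda>m. (\<forall>q. 0 \<le> m q \<and> m q \<le> 1) \<and> (\<forall>q\<in>set qs. worth (\<mu> q) (left_of (m q) gs) = \<alpha>))"
  using assms(4)
proof (induction qs)
  case (Cons q qs)
  have q: "value_function (\<mu> q)" "\<alpha> \<le> worth (\<mu> q) gs" using Cons.prems by auto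
  have IH: "achieves \<mu> (marks gs \<alpha> qs) (length qs * Suc (length gs)) 0
      (\<lambda>m. (\<forall>q. 0 \<le> m q \<and> m q \<le> 1) \<and> (\<forall>q\<in>set qs. worth (\<mu> q) (left_of (m q) gs) = \<alpha>))"
    using Cons by simp
  have "achieves \<mu> (marks gs \<alpha> (q # qs)) (Suc (length gs) + (length qs * Suc (length gs) + 0)) 0
      (\<lambda>m. (\<forall>q. 0 \<le> m q \<and> m q \<le> 1) \<and> (\<forall>q\<in>set (q # qs). worth (\<mu> q) (left_of (m q) gs) = \<alpha>))"
    unfolding marks.simps
    by (rule achieves_bind0[OF achieves_mark[of \<mu> q 0, OF q(1) assms(1) order.refl assms(2,3) q(2)]]
          achieves_bind0[OF IH])+ (auto intro!: achieves_Return)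
  then show ?case by (simp add: ac_simps)
qed (simp add: achieves_Return)

text \<open>
  The Even--Paz algorithm with absolute instead of relative shares, which makes evaluation
  queries for the current piece superfluous.
\<close>

primrec even_paz :: "nat \<Rightarrow> nat \<Rightarrow> nat list \<Rightarrow> (real \<times> real) list \<Rightarrow> assignment rw_algorithm" where
  "even_paz n 0 qs gs = Return (\<lambda>q. if q \<in> set qs then pieces gs else {})"
| "even_paz n (Suc d) qs gs =
     (let h = length qs div 2 in
      rw_bind (marks gs (real h / real n) qs) (\<lambda>m.
        let ps = sort_key m qs; x = m (ps ! h) in
        rw_bind (even_paz n d (take h ps) (left_of x gs)) (\<lambda>Y.
        rw_bind (even_paz n d (drop h ps) (right_of x gs)) (\<lambda>Z.
        Return (\<lambda>q. if q \<in> set (take h ps) then Y q else Z q)))))"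

definition divides :: "nat \<Rightarrow> (nat \<Rightarrow> real set \<Rightarrow> real) \<Rightarrow> nat list \<Rightarrow> real set \<Rightarrow> assignment \<Rightarrow> bool" where
  "divides n \<mu> qs C Y \<longleftrightarrow>
     (\<forall>q\<in>set qs. fair_portion n (\<mu> q) (Y q)) \<and> (\<forall>q. \<Union>(Y q) \<subseteq> C) \<and>
     (\<forall>q. q \<notin> set qs \<longrightarrow> Y q = {}) \<and> (\<forall>q q'. q \<noteq> q' \<longrightarrow> \<Union>(Y q) \<inter> \<Union>(Y q') = {})"

lemma divides_combine:
  assumes Y: "divides n \<mu> ps C Y" and Z: "divides n \<mu> qs D Z"
    and "C \<inter> D = {}" "C \<subseteq> E" "D \<subseteq> E" "set rs = set ps \<union> set qs" "set ps \<inter> set qs = {}"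
  shows "divides n \<mu> rs E (\<lambda>q. if q \<in> set ps then Y q else Z q)"
proof -
  have sub: "\<Union>(Y q) \<subseteq> C" "\<Union>(Z q) \<subseteq> D" for q using Y Z by (auto simp: divides_def)
  have "\<Union>(Y q) \<inter> \<Union>(Z q') = {}" for q q' using sub[of q] sub[of q'] assms(3) by blast
  moreover have "\<Union>(Y q) \<subseteq> E" "\<Union>(Z q) \<subseteq> E" for q using sub[of q] assms(4,5) by blast+
  ultimately show ?thesis
    using Y Z assms(6,7) by (auto simp: divides_def Int_commute)
qed

text \<open>Whoever marks no later than the cut values the left part at least at h / n. Whoever
  marks no earlier values it at most at h / n and so keeps the rest of her claim on the right.
  Claims are multiples of 1 / n throughout, so a single remaining player owns a fair
  portion.\<close>

lemma achieves_even_paz: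
  assumes "\<And>q. q \<in> set qs \<Longrightarrow> value_function (\<mu> q)"
    and "distinct qs" "length qs \<le> 2 ^ d" "gaps 0 gs" "gs \<noteq> []"
    and "\<And>q. q \<in> set qs \<Longrightarrow> real (length qs) / real n \<le> worth (\<mu> q) gs"
  shows "achieves \<mu> (even_paz n d qs gs) (d * length qs * Suc (length gs)) 0
           (divides n \<mu> qs (\<Union>(pieces gs)))"
  using assms
proof (induction d arbitrary: qs gs)
  case 0
  consider "qs = []" | q where "qs = [q]"
    using "0.prems"(3) by (cases qs) auto
  then show ?case
  proof cases
    case 1 then show ?thesis by (auto intro!: achieves_Return simp: divides_def)
  next
    case 2
    then have "fair_portion n (\<mu> q) (pieces gs)"
      using "0.prems" worth_pieces[of "\<mu> q" 0 gs] is_portion_pieces[of 0 gs]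
      by (auto simp: fair_portion_def)
    then show ?thesis using 2 by (auto intro!: achieves_Return simp: divides_def split: if_splits)
  qed
next
  case (Suc d)
  define h where "h = length qs div 2"
  define c where "c = Suc (length gs)"
  have split: "achieves \<mu> (rw_bind (even_paz n d (take h ps) (left_of x gs)) (\<lambda>Y.
        rw_bind (even_paz n d (drop h ps) (right_of x gs)) (\<lambda>Z.
        Return (\<lambda>q. if q \<in> set (take h ps) then Y q else Z q))))
        (d * h * c + (d * (length qs - h) * c + 0)) 0 (divides n \<mu> qs (\<Union>(pieces gs)))"
    if m: "\<forall>q. 0 \<le> m q \<and> m q \<le> 1" "\<forall>q\<in>set qs. worth (\<mu> q) (left_of (m q) gs) = real h / real n"
      and ps: "ps = sort_key m qs" and x: "x = m (ps ! h)" for m ps x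
  proof -
    have set: "set ps = set qs" "length ps = length qs" "distinct ps" "sorted (map m ps)"
      using ps Suc.prems(2) by auto
    have x01: "0 \<le> x" "x \<le> 1" using m x by auto
    have gl: "gaps 0 (left_of x gs)" "gaps 0 (right_of x gs)"
      using gaps_left_of[OF Suc.prems(4), of x] gaps_right_of[OF Suc.prems(4), of x] x01
      by (auto simp: min_def max_def intro: gaps_mono)
    have len': "length (take h ps) = h" "length (drop h ps) = length qs - h"
      using set unfolding h_def by auto
    have ne: "left_of x gs \<noteq> []" "right_of x gs \<noteq> []"
      using Suc.prems(5) by (auto simp: left_of_def right_of_def)
    have len: "h \<le> 2 ^ d" "length qs - h \<le> 2 ^ d" "h \<le> length qs"
      using Suc.prems(3) unfolding h_def by auto
    have L: "real h / real n \<le> worth (\<mu> q) (left_of x gs)" if q: "q \<in> set (take h ps)" for q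
    proof -
      have qs: "q \<in> set qs" using q set in_set_takeD by fastforce
      \<comment> \<open>The list is nonempty here, and half of a positive length is smaller than it,
        so \<open>ps ! h\<close> is a genuine entry.\<close>
      then have "h < length ps" using len set q unfolding h_def by (cases qs) auto
      obtain i where i: "i < h" "i < length ps" "q = ps ! i"
        using q by (auto simp: in_set_conv_nth)
      have "m q \<le> x"
        using sorted_nth_mono[OF set(4), of i h] i \<open>h < length ps\<close> x by auto
      then show ?thesis
        using worth_left_mono[OF _ Suc.prems(4), of "\<mu> q" "m q" x] m qs x01 Suc.prems(1)[of q] by auto
    qed
    have R: "real (length qs - h) / real n \<le> worth (\<mu> q) (right_of x gs)"
      if q: "q \<in> set (drop h ps)" for q
    proof -
      have qs: "q \<in> set qs" using q set in_set_dropD by fastforce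
      obtain i where i: "h \<le> i" "i < length ps" "q = ps ! i"
        using q by (auto simp: in_set_conv_nth) (metis le_add1 less_diff_conv add.commute)
      have "x \<le> m q"
        using sorted_nth_mono[OF set(4), of h i] i x by auto
      then have "worth (\<mu> q) (left_of x gs) \<le> real h / real n"
        using worth_left_mono[OF _ Suc.prems(4), of "\<mu> q" x "m q"] m qs x01 Suc.prems(1)[of q] by auto
      moreover have "real (length qs - h) / real n = real (length qs) / real n - real h / real n"
        using len by (simp add: of_nat_diff diff_divide_distrib)
      ultimately show ?thesis
        using worth_left_right[OF Suc.prems(1)[OF qs] Suc.prems(4), of x] Suc.prems(6)[OF qs] x01
        by linarith
    qed
    have A: "achieves \<mu> (even_paz n d (take h ps) (left_of x gs)) (d * h * c) 0
        (divides n \<mu> (take h ps) (\<Union>(pieces (left_of x gs))))"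
      using Suc.IH[of "take h ps" "left_of x gs", unfolded len'] L gl ne len set Suc.prems(1)
      by (auto simp: c_def dest: in_set_takeD)
    have B: "achieves \<mu> (even_paz n d (drop h ps) (right_of x gs)) (d * (length qs - h) * c) 0
        (divides n \<mu> (drop h ps) (\<Union>(pieces (right_of x gs))))"
      using Suc.IH[of "drop h ps" "right_of x gs", unfolded len'] R gl ne len set Suc.prems(1)
      by (auto simp: c_def dest: in_set_dropD)
    show ?thesis
    proof (rule achieves_bind0[OF A], rule achieves_bind0[OF B], rule achieves_Return)
      fix Y Z
      assume "divides n \<mu> (take h ps) (\<Union> (pieces (left_of x gs))) Y"
        "divides n \<mu> (drop h ps) (\<Union> (pieces (right_of x gs))) Z"
      then show "divides n \<mu> qs (\<Union> (pieces gs)) (\<lambda>q. if q \<in> set (take h ps) then Y q else Z q)"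
      proof (rule divides_combine)
        show "set qs = set (take h ps) \<union> set (drop h ps)"
          using set by (metis append_take_drop_id set_append)
        show "set (take h ps) \<inter> set (drop h ps) = {}"
          using set by (intro set_take_disj_set_drop_if_distinct) auto
      qed (auto simp: Union_left_of Union_right_of simp del: Union_iff)
    qed auto
  qed
  have "achieves \<mu> (even_paz n (Suc d) qs gs)
      (length qs * c + (d * h * c + (d * (length qs - h) * c + 0))) 0
      (divides n \<mu> qs (\<Union>(pieces gs)))"
    unfolding even_paz.simps Let_def h_def[symmetric]
  proof (rule achieves_bind0)
    show "achieves \<mu> (marks gs (real h / real n) qs) (length qs * c) 0
      (\<lambda>m. (\<forall>q. 0 \<le> m q \<and> m q \<le> 1) \<and> (\<forall>q\<in>set qs. worth (\<mu> q) (left_of (m q) gs) = real h / real n))"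
      unfolding c_def
    proof (rule achieves_marks)
      fix q assume q: "q \<in> set qs"
      have "real h / real n \<le> real (length qs) / real n"
        unfolding h_def by (intro divide_right_mono) auto
      then show "value_function (\<mu> q) \<and> real h / real n \<le> worth (\<mu> q) gs"
        using Suc.prems(1,6)[OF q] by linarith
    qed (use Suc.prems in auto)
  qed (use split in auto)
  moreover have "d * h * c + d * (length qs - h) * c = d * length qs * c"
    unfolding h_def by (metis add_mult_distrib add_mult_distrib2 div_le_dividend le_add_diff_inverse)
  ultimately show ?case by (simp add: c_def algebra_simps)
qed

section \<open>Choosing a half by sampling\<close>

text \<open>For negative x multiply by 1 - x > 0: the left side becomes at most 1, because 1 - x
  \<le> exp (- x), and the right side becomes 1 - x ^ 3 \<ge> 1.\<close>

lemma exp_le_quadratic: "exp x \<le> 1 + x + x\<^sup>2" if "x \<le> 1" for x :: real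
proof (cases "0 \<le> x")
  case True then show ?thesis using exp_bound that by blast
next
  case False
  have "1 - x \<le> exp (- x)" using exp_ge_add_one_self[of "- x"] by simp
  then have "exp x * (1 - x) \<le> exp x * exp (- x)" by (intro mult_left_mono) auto
  also have "\<dots> = 1" by (simp flip: exp_add)
  also have "1 \<le> 1 - x * x\<^sup>2" using False by (simp add: mult_nonpos_nonneg)
  also have "\<dots> = (1 + x + x\<^sup>2) * (1 - x)" by (simp add: algebra_simps power2_eq_square)
  finally show ?thesis using False by simp
qed

section \<open>Votes by random samples\<close>

primrec score :: "nat pmf \<Rightarrow> real \<Rightarrow> real \<Rightarrow> real \<Rightarrow> (real \<Rightarrow> real \<Rightarrow> real) \<Rightarrow> nat \<Rightarrow> real \<Rightarrow> real rw_algorithm"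
where
  "score D a m b g 0 y = Return y"
| "score D a m b g (Suc s) y = Random D (\<lambda>q. Eval a b q b (\<lambda>v. Eval a b q m (\<lambda>w.
     score D a m b g s (y + g v w))))"

text \<open>An exponential Markov bound by induction on the draws: \<open>exp (\<theta> * y)\<close>
  records the score so far and each fresh draw contributes a factor \<open>M\<close>. At the end a
  wrong sign makes the bound at least 1, hence trivial. The sign of \<theta> selects which sign of
  the score is guaranteed.\<close>

lemma achieves_score:
  fixes \<mu> :: "nat \<Rightarrow> real set \<Rightarrow> real" and \<theta> :: real
  assumes ab: "0 \<le> a" "a \<le> m" "m \<le> b" "b \<le> 1" and D: "finite (set_pmf D)"
    and M: "measure_pmf.expectation D (\<lambda>q. exp (\<theta> * g (\<mu> q {a..b}) (\<mu> q {a..m}))) \<le> M"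
  shows "achieves \<mu> (score D a m b g s y) (2 * s) (exp (\<theta> * y) * M ^ s) (\<lambda>z. \<theta> * z < 0)"
proof (induction s arbitrary: y)
  case 0
  then show ?case by (cases "\<theta> * y < 0") (auto intro: achieves_Return achieves_trivial)
next
  case (Suc s)
  let ?g = "\<lambda>q. g (\<mu> q {a..b}) (\<mu> q {a..m})"
  have M0: "0 \<le> M"
  proof -
    have "0 \<le> measure_pmf.expectation D (\<lambda>q. exp (\<theta> * ?g q))"
      by (rule Bochner_Integration.integral_nonneg) simp
    then show ?thesis using M by linarith
  qed
  have "achieves \<mu> (Eval a b q b (\<lambda>v. Eval a b q m (\<lambda>w. score D a m b g s (y + g v w))))
      (2 * Suc s) (exp (\<theta> * (y + ?g q)) * M ^ s) (\<lambda>z. \<theta> * z < 0)" for q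
    using Suc[of "y + ?g q"] ab by (simp add: achieves_Eval eval_answer_def)
  then have "measure_pmf.prob (run \<mu> (score D a m b g (Suc s) y))
      {(z, q). \<not> (\<theta> * z < 0 \<and> q \<le> 2 * Suc s)}
      \<le> measure_pmf.expectation D (\<lambda>q. exp (\<theta> * (y + ?g q)) * M ^ s)"
    unfolding score.simps run.simps(4) prob_bind_pmf achieves_def
    by - (rule integral_mono[OF integrable_measure_pmf_finite[OF D] integrable_measure_pmf_finite[OF D]])
  also have "\<dots> = exp (\<theta> * y) * M ^ s * measure_pmf.expectation D (\<lambda>q. exp (\<theta> * ?g q))"
    by (simp add: distrib_left exp_add mult_ac)
  also have "\<dots> \<le> exp (\<theta> * y) * M ^ s * M"
    using M M0 by (intro mult_left_mono) auto
  finally show ?case by (simp add: achieves_def mult_ac)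
qed

text \<open>For the case that both halves are acceptable, when the outcome of the vote is irrelevant
  and only its cost matters.\<close>

lemma score_queries: "achieves \<mu> (score D a m b g s y) (2 * s) 0 (\<lambda>_. True)"
proof (induction s arbitrary: y)
  case (Suc s)
  have "achieves \<mu> (Eval a b q b (\<lambda>v. Eval a b q m (\<lambda>w. score D a m b g s (y + g v w))))
      (2 * Suc s) 0 (\<lambda>_. True)" for q
    using Suc by (simp add: achieves_Eval)
  then have "measure_pmf.prob (run \<mu> (Eval a b q b (\<lambda>v. Eval a b q m
      (\<lambda>w. score D a m b g s (y + g v w))))) {(y, q). \<not> (True \<and> q \<le> 2 * Suc s)} = 0" for q
    by (intro order.antisym) (simp_all only: achieves_def measure_nonneg)
  then show ?case
    unfolding score.simps achieves_def run.simps(4) prob_bind_pmf by simp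
qed (simp add: achieves_Return)

text \<open>Left value minus right value in units of \<tau>, hence in [-1, 1]. Players above \<tau>
  abstain: their truncated value is already maximal and cannot grow.\<close>

definition gain :: "real \<Rightarrow> real \<Rightarrow> real \<Rightarrow> real" where
  "gain \<tau> v w = (if v \<le> \<tau> then (2 * w - v) / \<tau> else 0)"

text \<open>The owner's value \<open>v\<close> is a parameter rather than a query: every cut splits
  it exactly, so it is known in advance in all rounds.\<close>

definition halve :: "nat pmf \<Rightarrow> nat \<Rightarrow> real \<Rightarrow> nat \<Rightarrow> real \<Rightarrow> real \<times> real \<Rightarrow> (real \<times> real) rw_algorithm"
where
  "halve D s \<tau> p v I = Cut (fst I) (snd I) p (v / 2) (\<lambda>x.
     rw_bind (score D (fst I) (the x) (snd I) (gain \<tau>) s 0) (\<lambda>y.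
       Return (if y < 0 then (fst I, the x) else (the x, snd I))))"

primrec narrow ::
  "nat pmf \<Rightarrow> nat \<Rightarrow> nat \<Rightarrow> real \<Rightarrow> nat \<Rightarrow> real \<Rightarrow> real \<times> real \<Rightarrow> (real \<times> real) rw_algorithm"
where
  "narrow D s 0 \<tau> p v I = Return I"
| "narrow D s (Suc k) \<tau> p v I = rw_bind (halve D s \<tau> p v I) (narrow D s k (3 / 4 * \<tau>) p (v / 2))"

section \<open>Expectations over one sampled player\<close>

locale sampling =
  fixes D :: "nat pmf" and \<mu> :: "nat \<Rightarrow> real set \<Rightarrow> real"
  assumes finite_D: "finite (set_pmf D)"
    and value_D: "\<And>q. q \<in> set_pmf D \<Longrightarrow> value_function (\<mu> q)"
begin

abbreviation "E \<equiv> measure_pmf.expectation D"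

lemma E_mono: "(\<And>q. q \<in> set_pmf D \<Longrightarrow> f q \<le> g q) \<Longrightarrow> E f \<le> (E g :: real)"
  by (intro integral_mono_AE integrable_measure_pmf_finite finite_D) (simp add: AE_measure_pmf_iff)

lemma E_add: "E (\<lambda>q. f q + g q) = E f + (E g :: real)"
  by (intro Bochner_Integration.integral_add integrable_measure_pmf_finite finite_D)

lemma E_diff: "E (\<lambda>q. f q - g q) = E f - (E g :: real)"
  by (intro Bochner_Integration.integral_diff integrable_measure_pmf_finite finite_D)

definition truncated_value :: "real \<Rightarrow> real \<Rightarrow> real \<Rightarrow> real" where
  "truncated_value \<tau> a b = E (\<lambda>q. min (\<mu> q {a..b} / \<tau>) 1)"

text \<open>The gain is at most 1 and at most the light value in modulus, so its square is at most
  the light value too. The quadratic term thus becomes linear in \<open>u\<close>, which later makes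
  the sample size grow like 1 / \<eta> instead of 1 / \<eta> ^ 2.\<close>

lemma E_gain:
  assumes "a \<le> b" "0 \<le> a" "b \<le> 1" "0 < \<tau>"
    and v01: "\<And>q. q \<in> set_pmf D \<Longrightarrow> 0 \<le> w q \<and> w q \<le> \<mu> q {a..b}"
    and x: "x = E (\<lambda>q. if \<mu> q {a..b} \<le> \<tau> then w q / \<tau> else 0)"
    and u: "u = E (\<lambda>q. if \<mu> q {a..b} \<le> \<tau> then \<mu> q {a..b} / \<tau> else 0)"
    and \<theta>: "\<bar>\<theta>\<bar> = 1 / 4"
  shows "E (\<lambda>q. exp (\<theta> * gain \<tau> (\<mu> q {a..b}) (w q))) \<le> exp (\<theta> * (2 * x - u) + u / 16)"
proof -
  let ?x = "\<lambda>q. if \<mu> q {a..b} \<le> \<tau> then w q / \<tau> else 0"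
  let ?u = "\<lambda>q. if \<mu> q {a..b} \<le> \<tau> then \<mu> q {a..b} / \<tau> else 0"
  have "E (\<lambda>q. exp (\<theta> * gain \<tau> (\<mu> q {a..b}) (w q)))
      \<le> E (\<lambda>q. 1 + (\<theta> * (2 * ?x q - ?u q) + 1 / 16 * ?u q))"
  proof (rule E_mono)
    fix q assume q: "q \<in> set_pmf D"
    define z where "z = gain \<tau> (\<mu> q {a..b}) (w q)"
    have z: "z = 2 * ?x q - ?u q" by (simp add: z_def gain_def diff_divide_distrib)
    have xu: "0 \<le> ?x q" "?x q \<le> ?u q" "?u q \<le> 1"
      using v01[OF q] assms(4) by (auto simp: divide_right_mono)
    then have zu: "\<bar>z\<bar> \<le> ?u q" "\<bar>z\<bar> \<le> 1" unfolding z by linarith+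
    have "\<bar>z\<bar> * \<bar>z\<bar> \<le> ?u q * 1" by (rule mult_mono) (use zu xu in auto)
    then have z2: "z\<^sup>2 \<le> ?u q" by (simp add: power2_eq_square)
    have "\<theta>\<^sup>2 = (1 / 4)\<^sup>2" using \<theta> by (metis power2_abs)
    then have "\<theta>\<^sup>2 = 1 / 16" by (simp add: power2_eq_square)
    then have "(\<theta> * z)\<^sup>2 = 1 / 16 * z\<^sup>2" by (simp only: power_mult_distrib)
    then have "(\<theta> * z)\<^sup>2 \<le> 1 / 16 * ?u q" using z2 by linarith
    moreover have "\<theta> * z \<le> \<bar>\<theta>\<bar> * \<bar>z\<bar>" by (metis abs_ge_self abs_mult)
    then have "\<theta> * z \<le> 1" using \<theta> zu by simp
    ultimately show "exp (\<theta> * gain \<tau> (\<mu> q {a..b}) (w q))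
        \<le> 1 + (\<theta> * (2 * ?x q - ?u q) + 1 / 16 * ?u q)"
      using exp_le_quadratic[of "\<theta> * z"] by (simp add: z_def[symmetric] z[symmetric])
  qed
  also have "\<dots> = 1 + (\<theta> * (2 * x - u) + u / 16)"
    unfolding E_add by (simp add: E_diff x u)
  also have "\<dots> \<le> exp (\<theta> * (2 * x - u) + u / 16)" by (rule exp_ge_add_one_self)
  finally show ?thesis .
qed

text \<open>Players above \<tau> already count 1. For the others the smaller threshold enlarges
  ratios by 4/3, which turns 3/4 * u back into u and \<eta> into 4/3 * \<eta>.\<close>

lemma truncated_value_step:
  assumes "0 \<le> a" "a \<le> c" "c \<le> d" "d \<le> b" "b \<le> 1" "0 < \<tau>" "0 \<le> \<eta>"
    and x: "x = E (\<lambda>q. if \<mu> q {a..b} \<le> \<tau> then \<mu> q {c..d} / \<tau> else 0)"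
    and u: "u = E (\<lambda>q. if \<mu> q {a..b} \<le> \<tau> then \<mu> q {a..b} / \<tau> else 0)"
    and le: "x \<le> max (3 / 4 * u) \<eta>"
  shows "truncated_value (3 / 4 * \<tau>) c d \<le> truncated_value \<tau> a b + 4 / 3 * \<eta>"
proof -
  let ?h = "\<lambda>q. if \<mu> q {a..b} \<le> \<tau> then 0 else 1 :: real"
  have "truncated_value (3 / 4 * \<tau>) c d
      \<le> E (\<lambda>q. ?h q + 4 / 3 * (if \<mu> q {a..b} \<le> \<tau> then \<mu> q {c..d} / \<tau> else 0))"
    unfolding truncated_value_def
  proof (rule E_mono)
    fix q
    have "\<mu> q {c..d} / (3 / 4 * \<tau>) = 4 / 3 * (\<mu> q {c..d} / \<tau>)" by simp
    then show "min (\<mu> q {c..d} / (3 / 4 * \<tau>)) 1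
        \<le> ?h q + 4 / 3 * (if \<mu> q {a..b} \<le> \<tau> then \<mu> q {c..d} / \<tau> else 0)"
      by (cases "\<mu> q {a..b} \<le> \<tau>") simp_all
  qed
  also have "\<dots> = E ?h + 4 / 3 * x" unfolding E_add by (simp add: x)
  also have "\<dots> \<le> E ?h + (u + 4 / 3 * \<eta>)"
  proof -
    have "E (\<lambda>_. 0) \<le> u" unfolding u
      by (rule E_mono) (use assms value_nonneg[OF value_D, of _ a b] in simp)
    then have "0 \<le> u" by simp
    then show ?thesis using le assms(7) by auto
  qed
  also have "E ?h + u = truncated_value \<tau> a b"
    unfolding u E_add[symmetric] truncated_value_def
    using \<open>0 < \<tau>\<close> by (intro Bochner_Integration.integral_cong) (auto simp: min_def)
  then have "E ?h + (u + 4 / 3 * \<eta>) = truncated_value \<tau> a b + 4 / 3 * \<eta>" by simp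
  finally show ?thesis .
qed

text \<open>
  If one half carries more than three quarters of the light players' value \<open>u\<close>, then the score
  points away from it by a constant multiple of \<open>u\<close>, which the exponential moment detects.
\<close>

lemma achieves_halve:
  assumes I: "0 \<le> a" "a \<le> b" "b \<le> 1" and p: "value_function (\<mu> p)" "\<mu> p {a..b} = v"
    and \<tau>: "0 < \<tau>" and \<eta>: "0 \<le> \<eta>"
  shows "achieves \<mu> (halve D s \<tau> p v (a, b)) (Suc (2 * s)) (exp (- \<eta> / 12 * real s))
     (\<lambda>(c, d). a \<le> c \<and> c \<le> d \<and> d \<le> b \<and> \<mu> p {c..d} = v / 2 \<and>
        truncated_value (3 / 4 * \<tau>) c d \<le> truncated_value \<tau> a b + 4 / 3 * \<eta>)"
    (is "achieves _ _ _ ?\<delta> ?P")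
proof -
  have v0: "0 \<le> v" using value_nonneg[OF p(1)] I p(2) by blast
  obtain m where m: "cut_answer (\<mu> p) a b (v / 2) = Some m" "m \<in> {a..b}" "\<mu> p {a..m} = v / 2"
    using cut_answer_least[OF p(1) I(1-3), of "v / 2"] v0 p(2) by auto
  have am: "a \<le> m" "m \<le> b" using m by auto
  have mb: "\<mu> p {m..b} = v / 2" using value_split_closed[OF p(1) I(1) am I(3)] p(2) m(3) by simp
  define x where "x = E (\<lambda>q. if \<mu> q {a..b} \<le> \<tau> then \<mu> q {a..m} / \<tau> else 0)"
  define x' where "x' = E (\<lambda>q. if \<mu> q {a..b} \<le> \<tau> then \<mu> q {m..b} / \<tau> else 0)"
  define u where "u = E (\<lambda>q. if \<mu> q {a..b} \<le> \<tau> then \<mu> q {a..b} / \<tau> else 0)"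
  have sum: "x + x' = u"
    unfolding x_def x'_def u_def E_add[symmetric] using I am
    by (intro order.antisym E_mono) (simp_all add: add_divide_distrib
        value_split_closed[OF value_D I(1) am I(3)])
  have good: "?P (a, m)" if "x \<le> max (3 / 4 * u) \<eta>"
    using truncated_value_step[of a a m b \<tau> \<eta> x u] that I am m \<tau> \<eta> x_def u_def by simp
  have good': "?P (m, b)" if "x' \<le> max (3 / 4 * u) \<eta>"
    using truncated_value_step[of a m b b \<tau> \<eta> x' u] that I am mb \<tau> \<eta> x'_def u_def by simp
  have mgf: "E (\<lambda>q. exp (\<theta> * gain \<tau> (\<mu> q {a..b}) (\<mu> q {a..m}))) \<le> exp (\<theta> * (2 * x - u) + u / 16)"
    if "\<bar>\<theta>\<bar> = 1 / 4" for \<theta>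
    by (rule E_gain[OF I(2,1,3) \<tau> _ x_def u_def that])
      (use I am value_nonneg[OF value_D] value_mono[OF value_D] in simp)
  have sample: "achieves \<mu> (score D a m b (gain \<tau>) s 0) (2 * s) ?\<delta> (\<lambda>z. \<theta> * z < 0)"
    if \<theta>: "\<bar>\<theta>\<bar> = 1 / 4" and le: "\<theta> * (2 * x - u) + u / 16 \<le> - \<eta> / 12" for \<theta>
  proof -
    have "E (\<lambda>q. exp (\<theta> * gain \<tau> (\<mu> q {a..b}) (\<mu> q {a..m}))) \<le> exp (- \<eta> / 12)"
      using mgf[OF \<theta>] le by (meson exp_le_cancel_iff order.trans)
    from achieves_score[where g = "gain \<tau>" and \<mu> = \<mu> and \<theta> = \<theta>, OF I(1) am I(3) finite_D this, of s 0]
    show ?thesis by (simp add: exp_of_nat2_mult[symmetric] mult.commute)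
  qed
  have "achieves \<mu> (score D a m b (gain \<tau>) s 0) (2 * s) ?\<delta>
      (\<lambda>y. ?P (if y < 0 then (a, m) else (m, b)))"
  proof -
    consider "x > max (3 / 4 * u) \<eta>" | "x' > max (3 / 4 * u) \<eta>"
      | "x \<le> max (3 / 4 * u) \<eta>" "x' \<le> max (3 / 4 * u) \<eta>" by linarith
    then show ?thesis
    proof cases
      case 1
      then have "x' \<le> max (3 / 4 * u) \<eta>" using sum \<eta> by (auto simp: max_def split: if_splits)
      moreover have "achieves \<mu> (score D a m b (gain \<tau>) s 0) (2 * s) ?\<delta> (\<lambda>z. (- 1 / 4) * z < 0)"
      proof (rule sample)
        have "x > 3 / 4 * u" "x > \<eta>" using 1 by simp_all
        \<comment> \<open>The left side is - x / 2 + 5 / 16 * u. As u < 4/3 * x, this is below - x /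
          12, the origin of the constant 12.\<close>
        then show "- 1 / 4 * (2 * x - u) + u / 16 \<le> - \<eta> / 12" by argo
      qed simp
      ultimately show ?thesis by (elim achieves_weaken) (use good' in auto)
    next
      case 2
      then have "x \<le> max (3 / 4 * u) \<eta>" using sum \<eta> by (auto simp: max_def split: if_splits)
      moreover have "achieves \<mu> (score D a m b (gain \<tau>) s 0) (2 * s) ?\<delta> (\<lambda>z. (1 / 4) * z < 0)"
      proof (rule sample)
        have "x' > 3 / 4 * u" "x' > \<eta>" using 2 by simp_all
        \<comment> \<open>Since 2 * x - u = u - 2 * x', this is the previous estimate with x' for
          x.\<close>
        then show "1 / 4 * (2 * x - u) + u / 16 \<le> - \<eta> / 12" using sum by argo
      qed simp
      ultimately show ?thesis by (elim achieves_weaken) (use good in auto)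
    next
      case 3
      show ?thesis
        by (rule achieves_weaken[OF score_queries]) (use 3 good good' in auto)
    qed
  qed
  then have "achieves \<mu> (rw_bind (score D a m b (gain \<tau>) s 0) (\<lambda>y.
       Return (if y < 0 then (a, m) else (m, b)))) (2 * s + 0) (?\<delta> + 0) ?P"
    by (rule achieves_bind) (auto intro!: achieves_Return)
  then show ?thesis unfolding halve_def achieves_Cut fst_conv snd_conv m(1) option.sel by simp
qed

text \<open>The error 4/3 * \<eta> is the same in each round although \<tau> shrinks, because \<eta>
  bounds a value measured in units of the current \<tau>. So errors and failure probabilities simply
  add up.\<close>

lemma achieves_narrow:
  assumes "0 \<le> a" "a \<le> b" "b \<le> 1" "value_function (\<mu> p)" "\<mu> p {a..b} = v" "0 < \<tau>" and \<eta>: "0 \<le> \<eta>"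
  shows "achieves \<mu> (narrow D s k \<tau> p v (a, b)) (k * Suc (2 * s)) (real k * exp (- \<eta> / 12 * real s))
     (\<lambda>(c, d). a \<le> c \<and> c \<le> d \<and> d \<le> b \<and> \<mu> p {c..d} = v / 2 ^ k \<and>
        truncated_value ((3 / 4) ^ k * \<tau>) c d \<le> truncated_value \<tau> a b + real k * (4 / 3 * \<eta>))"
  using assms(1-6)
proof (induction k arbitrary: a b v \<tau>)
  case 0
  then show ?case by (auto intro!: achieves_Return)
next
  case (Suc k)
  let ?\<delta> = "exp (- \<eta> / 12 * real s)"
  have "achieves \<mu> (narrow D s (Suc k) \<tau> p v (a, b)) (Suc (2 * s) + k * Suc (2 * s)) (?\<delta> + real k * ?\<delta>)
     (\<lambda>(c, d). a \<le> c \<and> c \<le> d \<and> d \<le> b \<and> \<mu> p {c..d} = v / 2 ^ Suc k \<and>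
        truncated_value ((3 / 4) ^ Suc k * \<tau>) c d \<le> truncated_value \<tau> a b + real (Suc k) * (4 / 3 * \<eta>))"
    unfolding narrow.simps
  proof (rule achieves_bind[OF achieves_halve[OF Suc.prems \<eta>]], clarify)
    fix c d
    assume cd: "a \<le> c" "c \<le> d" "d \<le> b" "\<mu> p {c..d} = v / 2"
      "truncated_value (3 / 4 * \<tau>) c d \<le> truncated_value \<tau> a b + 4 / 3 * \<eta>"
    show "achieves \<mu> (narrow D s k (3 / 4 * \<tau>) p (v / 2) (c, d)) (k * Suc (2 * s)) (real k * ?\<delta>)
     (\<lambda>(c, d). a \<le> c \<and> c \<le> d \<and> d \<le> b \<and> \<mu> p {c..d} = v / 2 ^ Suc k \<and>
        truncated_value ((3 / 4) ^ Suc k * \<tau>) c d \<le> truncated_value \<tau> a b + real (Suc k) * (4 / 3 * \<eta>))"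
    proof (rule achieves_weaken[OF Suc.IH[of c d "v / 2" "3 / 4 * \<tau>"]])
      fix J
      assume J: "case J of (e, f) \<Rightarrow> c \<le> e \<and> e \<le> f \<and> f \<le> d \<and> \<mu> p {e..f} = v / 2 / 2 ^ k \<and>
        truncated_value ((3 / 4) ^ k * (3 / 4 * \<tau>)) e f
          \<le> truncated_value (3 / 4 * \<tau>) c d + real k * (4 / 3 * \<eta>)"
      obtain e f where ef: "J = (e, f)" by (cases J)
      have eqs: "(3 / 4) ^ k * (3 / 4 * \<tau>) = (3 / 4) ^ Suc k * \<tau>" "v / 2 / 2 ^ k = v / 2 ^ Suc k"
        "real (Suc k) * (4 / 3 * \<eta>) = 4 / 3 * \<eta> + real k * (4 / 3 * \<eta>)"
        by (simp_all add: ring_distribs)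
      show "case J of (c, d) \<Rightarrow> a \<le> c \<and> c \<le> d \<and> d \<le> b \<and> \<mu> p {c..d} = v / 2 ^ Suc k \<and>
        truncated_value ((3 / 4) ^ Suc k * \<tau>) c d \<le> truncated_value \<tau> a b + real (Suc k) * (4 / 3 * \<eta>)"
        using J cd unfolding ef prod.case eqs by (elim conjE, intro conjI; linarith)
    qed (use cd Suc.prems in auto)
  qed simp
  then show ?case by (simp add: algebra_simps)
qed

lemma truncated_value_le:
  assumes "0 \<le> a" "a \<le> b" "b \<le> 1" "0 < \<tau>"
  shows "truncated_value \<tau> a b \<le> 1 / \<tau>"
proof -
  have "truncated_value \<tau> a b \<le> E (\<lambda>_. 1 / \<tau>)"
    unfolding truncated_value_def
  proof (rule E_mono)
    fix q assume "q \<in> set_pmf D"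
    then have "\<mu> q {a..b} / \<tau> \<le> 1 / \<tau>"
      using value_le_1[OF value_D] assms by (intro divide_right_mono) auto
    then show "min (\<mu> q {a..b} / \<tau>) 1 \<le> 1 / \<tau>" by linarith
  qed
  then show ?thesis by simp
qed

text \<open>Turns a bound on a mean into one on a single player of large probability; it is meant
  for the members of R.\<close>

lemma E_ge_point:
  assumes "\<And>i. i \<in> set_pmf D \<Longrightarrow> 0 \<le> f i"
  shows "pmf D q * f q \<le> E f"
proof -
  have "E f = (\<Sum>i\<in>set_pmf D. pmf D i * f i)"
    by (subst integral_measure_pmf[OF finite_D]) auto
  moreover have "pmf D q * f q \<le> (\<Sum>i\<in>set_pmf D. pmf D i * f i)"
  proof (cases "q \<in> set_pmf D")
    case True
    then show ?thesis using assms finite_D by (intro member_le_sum) auto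
  next
    case False
    then show ?thesis using assms by (auto simp: set_pmf_iff intro!: sum_nonneg)
  qed
  ultimately show ?thesis by simp
qed

end

section \<open>The preassigning part\<close>

text \<open>The result for the empty list is a dummy: the pigeonhole hypothesis of
  \<open>achieves_carve\<close> keeps it from being reached. Both leftovers of the chosen gap are
  kept, even if empty, so the list grows by exactly one.\<close>

primrec carve ::
  "nat pmf \<Rightarrow> nat \<Rightarrow> nat \<Rightarrow> real \<Rightarrow> real \<Rightarrow> nat \<Rightarrow> (real \<times> real) list \<Rightarrow>
    ((real \<times> real) \<times> (real \<times> real) list) rw_algorithm"
where
  "carve D s k \<tau> \<beta> p [] = Return ((0, 0), [])"
| "carve D s k \<tau> \<beta> p (I # gs) = Eval (fst I) (snd I) p (snd I) (\<lambda>v.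
     if \<beta> \<le> v
     then rw_bind (narrow D s k \<tau> p v I)
       (\<lambda>J. Return (J, (fst I, fst J) # (snd J, snd I) # gs))
     else rw_bind (carve D s k \<tau> \<beta> p gs) (\<lambda>(J, gs'). Return (J, I # gs')))"

text \<open>The balance of worth is stated for all value functions, since the losses of all players
  must be tracked, whoever carves.\<close>

definition carved :: "real \<Rightarrow> (real \<times> real) list \<Rightarrow> real \<times> real \<Rightarrow> (real \<times> real) list \<Rightarrow> bool" where
  "carved y gs J gs' \<longleftrightarrow> y \<le> fst J \<and> fst J \<le> snd J \<and> snd J \<le> 1 \<and>
     gaps y gs' \<and> length gs' = Suc (length gs) \<and>
     \<Union>(pieces gs) = {fst J<..snd J} \<union> \<Union>(pieces gs') \<and> {fst J<..snd J} \<inter> \<Union>(pieces gs') = {} \<and>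
     (\<forall>\<nu>. value_function \<nu> \<longrightarrow> worth \<nu> gs = \<nu> {fst J..snd J} + worth \<nu> gs')"

lemma carved_here:
  assumes "gaps y ((a, b) # gs)" "0 \<le> y" "a \<le> c" "c \<le> d" "d \<le> b"
  shows "carved y ((a, b) # gs) (c, d) ((a, c) # (d, b) # gs)"
proof -
  have ab: "y \<le> a" "a \<le> b" "b \<le> 1" "gaps b gs" using assms gaps_le_1[of b gs] by auto
  have "\<Union>(pieces gs) \<subseteq> {b<..1}" using Union_pieces_subset ab by blast
  then have "{c<..d} \<inter> \<Union>(pieces gs) = {}" using assms by fastforce
  moreover have "{a<..b} = {c<..d} \<union> ({a<..c} \<union> {d<..b})" "{c<..d} \<inter> {a<..c} = {}" "{c<..d} \<inter> {d<..b} = {}"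
    using assms by auto
  moreover have "\<nu> {a..b} = \<nu> {c..d} + (\<nu> {a..c} + \<nu> {d..b})" if "value_function \<nu>" for \<nu>
    using value_split_closed[OF that, of a c b] value_split_closed[OF that, of c d b] assms ab by simp
  ultimately show ?thesis using assms ab by (auto simp: carved_def)
qed

lemma carved_later:
  assumes "gaps y ((a, b) # gs)" "0 \<le> y" "carved b gs J gs'"
  shows "carved y ((a, b) # gs) J ((a, b) # gs')"
proof -
  have ab: "y \<le> a" "a \<le> b" "b \<le> 1" "gaps b gs" using assms gaps_le_1[of b gs] by auto
  have "{fst J<..snd J} \<inter> {a<..b} = {}" using assms(3) by (auto simp: carved_def)
  then show ?thesis using assms ab by (auto simp: carved_def)
qed

lemma worth_le: "value_function \<mu> \<Longrightarrow> gaps x gs \<Longrightarrow> 0 \<le> x \<Longrightarrow> worth \<mu> gs \<le> \<mu> {x..1}"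
proof (induction gs arbitrary: x)
  case Nil
  then show ?case using value_nonneg[of \<mu> x 1] by simp
next
  case (Cons I gs)
  obtain a b where I: "I = (a, b)" by (cases I)
  have ab: "x \<le> a" "a \<le> b" "b \<le> 1" "gaps b gs" using Cons.prems gaps_le_1[of b gs] I by auto
  have "worth \<mu> gs \<le> \<mu> {b..1}" using Cons.IH[of b] Cons.prems ab by simp
  then show ?case using Cons.prems ab I value_split_closed[of \<mu> a b 1] value_mono[of \<mu> x a 1 1]
    by auto
qed

text \<open>Subadditivity of truncation, by which the means of separate portions bound the truncated
  total loss.\<close>

lemma min_add_le:
  fixes x y \<tau> :: real
  assumes "0 \<le> x" "0 \<le> y" "0 < \<tau>"
  shows "min ((x + y) / \<tau>) 1 \<le> min (x / \<tau>) 1 + min (y / \<tau>) 1"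
proof -
  have "0 \<le> x / \<tau>" "0 \<le> y / \<tau>" "(x + y) / \<tau> = x / \<tau> + y / \<tau>"
    using assms by (simp_all add: add_divide_distrib)
  then show ?thesis by linarith
qed

primrec preassign ::
  "nat pmf \<Rightarrow> nat \<Rightarrow> nat \<Rightarrow> real \<Rightarrow> real \<Rightarrow> nat list \<Rightarrow> (real \<times> real) list \<Rightarrow> assignment \<Rightarrow>
    (assignment \<times> (real \<times> real) list) rw_algorithm"
where
  "preassign D s k \<tau> \<beta> [] gs X = Return (X, gs)"
| "preassign D s k \<tau> \<beta> (p # ps) gs X = rw_bind (carve D s k \<tau> \<beta> p gs)
     (\<lambda>(J, gs'). preassign D s k \<tau> \<beta> ps gs' (X(p := {{fst J<..snd J}})))"

context sampling
begin

text \<open>Pigeonhole: if the first gap is worth less than \<beta>, the others still average at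
  least \<beta>, so the hypothesis survives the recursion. The summand 1 / \<tau> bounds the
  truncated mean of any gap, since no value exceeds 1.\<close>

lemma achieves_carve:
  assumes vf: "value_function (\<mu> p)" and \<tau>: "0 < \<tau>" and \<eta>: "0 \<le> \<eta>" and \<beta>: "0 \<le> \<beta>"
  shows "gaps y gs \<Longrightarrow> 0 \<le> y \<Longrightarrow> gs \<noteq> [] \<Longrightarrow> \<beta> * real (length gs) \<le> worth (\<mu> p) gs \<Longrightarrow>
    achieves \<mu> (carve D s k \<tau> \<beta> p gs) (length gs + k * Suc (2 * s))
      (real k * exp (- \<eta> / 12 * real s))
      (\<lambda>(J, gs'). carved y gs J gs' \<and> \<beta> / 2 ^ k \<le> \<mu> p {fst J..snd J} \<and>
         truncated_value ((3 / 4) ^ k * \<tau>) (fst J) (snd J) \<le> 1 / \<tau> + real k * (4 / 3 * \<eta>))"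
proof (induction gs arbitrary: y)
  case (Cons I gs)
  obtain a b where I: "I = (a, b)" by (cases I)
  have ab: "0 \<le> a" "a \<le> b" "b \<le> 1" "gaps b gs" using Cons.prems gaps_le_1[of b gs] I by auto
  let ?P = "\<lambda>y gs (J, gs'). carved y gs J gs' \<and> \<beta> / 2 ^ k \<le> \<mu> p {fst J..snd J} \<and>
         truncated_value ((3 / 4) ^ k * \<tau>) (fst J) (snd J) \<le> 1 / \<tau> + real k * (4 / 3 * \<eta>)"
  let ?\<delta> = "real k * exp (- \<eta> / 12 * real s)"
  show ?case
  proof (cases "\<beta> \<le> \<mu> p {a..b}")
    case True
    have "achieves \<mu> (rw_bind (narrow D s k \<tau> p (\<mu> p {a..b}) (a, b))
       (\<lambda>J. Return (J, (a, fst J) # (snd J, b) # gs))) (k * Suc (2 * s) + length gs) (?\<delta> + 0) (?P y (I # gs))"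
    proof (rule achieves_bind[OF achieves_narrow[OF ab(1-3) vf refl \<tau> \<eta>]], rule achieves_Return, clarify)
      fix c d
      assume cd: "a \<le> c" "c \<le> d" "d \<le> b" "\<mu> p {c..d} = \<mu> p {a..b} / 2 ^ k"
        "truncated_value ((3 / 4) ^ k * \<tau>) c d \<le> truncated_value \<tau> a b + real k * (4 / 3 * \<eta>)"
      have "\<beta> / 2 ^ k \<le> \<mu> p {a..b} / 2 ^ k" using True by (intro divide_right_mono) auto
      then show "carved y (I # gs) (c, d) ((a, fst (c, d)) # (snd (c, d), b) # gs) \<and>
        \<beta> / 2 ^ k \<le> \<mu> p {fst (c, d)..snd (c, d)} \<and>
        truncated_value ((3 / 4) ^ k * \<tau>) (fst (c, d)) (snd (c, d)) \<le> 1 / \<tau> + real k * (4 / 3 * \<eta>)"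
        using carved_here[of y a b gs c d] Cons.prems(1,2) I cd truncated_value_le[OF ab(1-3) \<tau>] by simp
    qed auto
    then show ?thesis using True I ab
      by (simp add: achieves_Eval eval_answer_whole ac_simps del: of_nat_Suc)
  next
    case False
    then have *: "\<beta> * real (length gs) \<le> worth (\<mu> p) gs" using Cons.prems(4) I by (simp add: algebra_simps)
    have "gs \<noteq> []" using False Cons.prems(4) I by auto
    have "achieves \<mu> (rw_bind (carve D s k \<tau> \<beta> p gs) (\<lambda>(J, gs'). Return (J, I # gs')))
       (length gs + k * Suc (2 * s) + 0) (?\<delta> + 0) (?P y (I # gs))"
    proof (rule achieves_bind[OF Cons.IH[OF ab(4) _ \<open>gs \<noteq> []\<close> *]], use ab in simp, clarify)
      fix c d gs'
      assume J: "carved b gs (c, d) gs'" "\<beta> / 2 ^ k \<le> \<mu> p {fst (c, d)..snd (c, d)}"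
        "truncated_value ((3 / 4) ^ k * \<tau>) (fst (c, d)) (snd (c, d)) \<le> 1 / \<tau> + real k * (4 / 3 * \<eta>)"
      have "carved y (I # gs) (c, d) (I # gs')" using carved_later[OF _ _ J(1), of y a] Cons.prems I by auto
      then show "achieves \<mu> (Return ((c, d), I # gs')) 0 0 (?P y (I # gs))"
        using J by (intro achieves_Return) auto
    qed simp
    then show ?thesis using False I ab
      by (simp add: achieves_Eval eval_answer_whole ac_simps)
  qed
qed simp

text \<open>Two bounds on the loss \<open>1 - worth\<close>: the mean one controls the crowd at the
  end, the pointwise one ensures that members of R not yet served find a good gap.\<close>

definition preassigned ::
  "nat set \<Rightarrow> real \<Rightarrow> real \<Rightarrow> real \<Rightarrow> nat set \<Rightarrow> assignment \<times> (real \<times> real) list \<Rightarrow> bool" where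
  "preassigned R \<beta> \<sigma> \<phi> S = (\<lambda>(X, gs). gaps 0 gs \<and> length gs = Suc (card S) \<and>
     (\<forall>p\<in>S. is_portion (X p) \<and> \<beta> \<le> \<mu> p (\<Union>(X p)) \<and> \<Union>(X p) \<inter> \<Union>(pieces gs) = {}) \<and>
     disjoint_family_on (\<lambda>p. \<Union>(X p)) S \<and>
     E (\<lambda>q. min ((1 - worth (\<mu> q) gs) / \<sigma>) 1) \<le> real (card S) * \<phi> \<and>
     (\<forall>p\<in>R. 1 - worth (\<mu> p) gs \<le> real (card S) * \<sigma>))"

lemma preassigned_step:
  assumes S: "preassigned R \<beta> \<sigma> \<phi> S (X, gs)" and p: "p \<in> R" "p \<notin> S" "finite S"
    and vf: "\<And>q. q \<in> R \<Longrightarrow> value_function (\<mu> q)"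
    and \<sigma>: "0 < \<sigma>" and \<phi>: "\<And>q. q \<in> R \<Longrightarrow> \<phi> < pmf D q"
    and J: "carved 0 gs J gs'" "\<beta> \<le> \<mu> p {fst J..snd J}" "truncated_value \<sigma> (fst J) (snd J) \<le> \<phi>"
  shows "preassigned R \<beta> \<sigma> \<phi> (insert p S) (X(p := {{fst J<..snd J}}), gs')"
proof -
  have c: "0 \<le> fst J" "fst J \<le> snd J" "snd J \<le> 1" "gaps 0 gs'" "length gs' = Suc (length gs)"
     "\<Union>(pieces gs) = {fst J<..snd J} \<union> \<Union>(pieces gs')" "{fst J<..snd J} \<inter> \<Union>(pieces gs') = {}"
     and w: "value_function (\<mu> q) \<Longrightarrow> worth (\<mu> q) gs = \<mu> q {fst J..snd J} + worth (\<mu> q) gs'" for q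
    using J(1) by (auto simp: carved_def)
  have s: "gaps 0 gs" "length gs = Suc (card S)"
     "\<forall>p\<in>S. is_portion (X p) \<and> \<beta> \<le> \<mu> p (\<Union>(X p)) \<and> \<Union>(X p) \<inter> \<Union>(pieces gs) = {}"
     "disjoint_family_on (\<lambda>p. \<Union>(X p)) S"
     "E (\<lambda>q. min ((1 - worth (\<mu> q) gs) / \<sigma>) 1) \<le> real (card S) * \<phi>"
     "\<forall>p\<in>R. 1 - worth (\<mu> p) gs \<le> real (card S) * \<sigma>"
    using S by (auto simp: preassigned_def)
  \<comment> \<open>A member of R with a value above \<sigma> would alone contribute her whole
    probability to the mean, which is more than \<phi>.\<close>
  have small: "\<mu> q {fst J..snd J} \<le> \<sigma>" if q: "q \<in> R" for q
  proof (rule ccontr)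
    assume "\<not> ?thesis"
    then have "1 \<le> \<mu> q {fst J..snd J} / \<sigma>" using \<sigma> by simp
    then have "pmf D q = pmf D q * min (\<mu> q {fst J..snd J} / \<sigma>) 1" by simp
    also have "\<dots> \<le> truncated_value \<sigma> (fst J) (snd J)"
      unfolding truncated_value_def
      by (rule E_ge_point) (use \<sigma> c value_nonneg[OF value_D] in simp)
    finally show False using J(3) \<phi>[OF q] by simp
  qed
  have "E (\<lambda>q. min ((1 - worth (\<mu> q) gs') / \<sigma>) 1)
      \<le> E (\<lambda>q. min ((1 - worth (\<mu> q) gs) / \<sigma>) 1 + min (\<mu> q {fst J..snd J} / \<sigma>) 1)"
  proof (rule E_mono)
    fix q assume q: "q \<in> set_pmf D"
    have "worth (\<mu> q) gs \<le> 1"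
      using worth_le[OF value_D[OF q] s(1)] value_D[OF q] by (simp add: value_function_def)
    moreover have eq: "1 - worth (\<mu> q) gs' = (1 - worth (\<mu> q) gs) + \<mu> q {fst J..snd J}"
      using w[OF value_D[OF q]] by simp
    ultimately show "min ((1 - worth (\<mu> q) gs') / \<sigma>) 1
        \<le> min ((1 - worth (\<mu> q) gs) / \<sigma>) 1 + min (\<mu> q {fst J..snd J} / \<sigma>) 1"
      unfolding eq using value_nonneg[OF value_D[OF q]] c \<sigma> by (intro min_add_le) auto
  qed
  also have "\<dots> \<le> real (card (insert p S)) * \<phi>"
    unfolding E_add using s(5) J(3) p by (simp add: truncated_value_def algebra_simps)
  finally have 5: "E (\<lambda>q. min ((1 - worth (\<mu> q) gs') / \<sigma>) 1) \<le> real (card (insert p S)) * \<phi>" .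
  have 6: "\<forall>q\<in>R. 1 - worth (\<mu> q) gs' \<le> real (card (insert p S)) * \<sigma>"
  proof
    fix q assume q: "q \<in> R"
    show "1 - worth (\<mu> q) gs' \<le> real (card (insert p S)) * \<sigma>"
      using w[OF vf[OF q]] small[OF q] s(6) q p by (auto simp: algebra_simps)
  qed
  have "is_portion {{fst J<..snd J}}"
    using c by (auto simp: is_portion_def is_interval_oc)
  moreover have "\<mu> p {fst J<..snd J} = \<mu> p {fst J..snd J}"
    using value_half_open[OF vf[OF p(1)] c(1-3)] .
  ultimately have 3: "\<forall>q\<in>insert p S. is_portion ((X(p := {{fst J<..snd J}})) q) \<and>
      \<beta> \<le> \<mu> q (\<Union>((X(p := {{fst J<..snd J}})) q)) \<and>
      \<Union>((X(p := {{fst J<..snd J}})) q) \<inter> \<Union>(pieces gs') = {}"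
    using s(3) c(6,7) J(2) p(2) by auto
  have "\<Union>(X q) \<inter> {fst J<..snd J} = {}" if "q \<in> S" for q
    using s(3) c(6) that by blast
  then have 4: "disjoint_family_on (\<lambda>q. \<Union>((X(p := {{fst J<..snd J}})) q)) (insert p S)"
    using s(4) p(2) by (auto simp: disjoint_family_on_def)
  show ?thesis
    using 3 4 5 6 c(4,5) s(2) p by (simp add: preassigned_def)
qed

text \<open>The hypothesis \<open>room\<close> reserves \<beta> for each of at most
  \<open>card R\<close> gaps and the final truncation level for each portion taken, which is what
  the pigeonhole in \<open>achieves_carve\<close> needs.\<close>

lemma achieves_preassign:
  assumes R: "finite R" "\<And>p. p \<in> R \<Longrightarrow> value_function (\<mu> p)"
    and \<phi>: "\<And>q. q \<in> R \<Longrightarrow> 1 / \<tau> + real k * (4 / 3 * \<eta>) < pmf D q"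
    and \<tau>: "0 < \<tau>" and \<eta>: "0 \<le> \<eta>" and \<beta>: "0 \<le> \<beta>"
    and room: "real (card R) * \<beta> + real (card R) * ((3 / 4) ^ k * \<tau>) \<le> 1"
  shows "preassigned R (\<beta> / 2 ^ k) ((3 / 4) ^ k * \<tau>) (1 / \<tau> + real k * (4 / 3 * \<eta>)) S (X, gs) \<Longrightarrow>
    distinct ps \<Longrightarrow> S \<inter> set ps = {} \<Longrightarrow> S \<union> set ps = R \<Longrightarrow>
    achieves \<mu> (preassign D s k \<tau> \<beta> ps gs X) (length ps * (card R + k * Suc (2 * s)))
      (real (length ps) * (real k * exp (- \<eta> / 12 * real s)))
      (preassigned R (\<beta> / 2 ^ k) ((3 / 4) ^ k * \<tau>) (1 / \<tau> + real k * (4 / 3 * \<eta>)) R)"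
proof (induction ps arbitrary: S X gs)
  case Nil
  then show ?case by (auto intro: achieves_Return)
next
  case (Cons p ps)
  let ?\<sigma> = "(3 / 4) ^ k * \<tau>" and ?\<phi> = "1 / \<tau> + real k * (4 / 3 * \<eta>)"
  let ?\<delta> = "real k * exp (- \<eta> / 12 * real s)" and ?P = "preassigned R (\<beta> / 2 ^ k)"
  have p: "p \<in> R" "p \<notin> S" "finite S" using Cons.prems R by auto
  have gs: "gaps 0 gs" "length gs = Suc (card S)" "1 - worth (\<mu> p) gs \<le> real (card S) * ?\<sigma>"
    using Cons.prems(1) p by (auto simp: preassigned_def)
  \<comment> \<open>There is one gap more than players served, and \<open>p\<close> is still
    unserved.\<close>
  have "Suc (card S) \<le> card R"
    using card_mono[of R "insert p S"] Cons.prems R p by auto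
  then have len: "length gs \<le> card R" "card S \<le> card R" using gs by auto
  have "\<beta> * real (length gs) \<le> \<beta> * real (card R)"
    using len \<beta> by (intro mult_left_mono) auto
  also have "\<dots> \<le> 1 - real (card R) * ?\<sigma>" using room by (simp add: mult.commute)
  also have "\<dots> \<le> 1 - real (card S) * ?\<sigma>" using len \<tau> by (simp add: mult_right_mono)
  also have "\<dots> \<le> worth (\<mu> p) gs" using gs(3) by simp
  finally have rich: "\<beta> * real (length gs) \<le> worth (\<mu> p) gs" .
  have ne: "gs \<noteq> []" using gs(2) by auto
  have "achieves \<mu> (preassign D s k \<tau> \<beta> (p # ps) gs X)
      (length gs + k * Suc (2 * s) + length ps * (card R + k * Suc (2 * s)))
      (?\<delta> + real (length ps) * ?\<delta>) (?P ?\<sigma> ?\<phi> R)"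
    unfolding preassign.simps
  proof (rule achieves_bind[OF achieves_carve[OF R(2)[OF p(1)] \<tau> \<eta> \<beta> gs(1) order.refl ne rich]], clarify)
    fix c d gs'
    assume J: "carved 0 gs (c, d) gs'" "\<beta> / 2 ^ k \<le> \<mu> p {fst (c, d)..snd (c, d)}"
      "truncated_value ?\<sigma> (fst (c, d)) (snd (c, d)) \<le> ?\<phi>"
    have "?P ?\<sigma> ?\<phi> (insert p S) (X(p := {{fst (c, d)<..snd (c, d)}}), gs')"
      using \<tau> \<phi> by (intro preassigned_step[OF Cons.prems(1) p R(2) _ _ J]) auto
    then show "achieves \<mu> (preassign D s k \<tau> \<beta> ps gs' (X(p := {{fst (c, d)<..snd (c, d)}})))
        (length ps * (card R + k * Suc (2 * s))) (real (length ps) * ?\<delta>) (?P ?\<sigma> ?\<phi> R)"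
      by (rule Cons.IH) (use Cons.prems in auto)
  qed simp
  then show ?case by (rule achieves_weaken) (use len in \<open>auto simp: algebra_simps\<close>)
qed

end

section \<open>The two-part algorithm\<close>

definition mixture :: "nat \<Rightarrow> nat set \<Rightarrow> nat pmf" where
  "mixture n R = bind_pmf (bernoulli_pmf (1 / 2)) (\<lambda>b. pmf_of_set (if b then {..<n} else R))"

lemma pmf_mixture:
  assumes "R \<subseteq> {..<n}" "R \<noteq> {}"
  shows "pmf (mixture n R) q = indicator {..<n} q / (2 * real n) + indicator R q / (2 * real (card R))"
proof -
  have "finite R" "{..<n} \<noteq> {}" using assms by (auto intro: finite_subset)
  then show ?thesis using assms(2) by (simp add: mixture_def pmf_bind)
qed

lemma set_pmf_mixture:
  assumes "R \<subseteq> {..<n}" "R \<noteq> {}"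
  shows "set_pmf (mixture n R) \<subseteq> {..<n}"
proof
  fix q assume "q \<in> set_pmf (mixture n R)"
  then have "pmf (mixture n R) q \<noteq> 0" by (simp add: set_pmf_iff)
  then show "q \<in> {..<n}" using assms(1) by (cases "q \<in> R") (auto simp: pmf_mixture[OF assms] split: split_indicator_asm)
qed

definition completion :: "nat \<Rightarrow> nat set \<Rightarrow> real \<Rightarrow> (real \<times> real) list \<Rightarrow> assignment rw_algorithm" where
  "completion n R \<epsilon> gs =
     rw_bind (contented gs (1 - \<epsilon> / 2) (filter (\<lambda>q. q \<notin> R) [0..<n])) (\<lambda>qs.
       even_paz n (nat \<lceil>log 2 (real n)\<rceil>) (take (n - card R - nat \<lfloor>\<epsilon> * real n\<rfloor>) qs) gs)"

text \<open>The victims do two jobs, both because their number f is at least \<epsilon> * n / 2: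
  they cover all players who lost more than \<epsilon> / 2, and they lower the total claim of the k
  others to k / n \<le> 1 - \<epsilon> / 2, which the contented players still own.\<close>

lemma achieves_completion:
  assumes vf: "\<And>q. q < n \<Longrightarrow> value_function (\<mu> q)" and R: "R \<subseteq> {..<n}"
    and \<epsilon>: "0 < \<epsilon>" "\<epsilon> \<le> 1" "1 \<le> \<epsilon> * real n"
    and gs: "gaps 0 gs" "gs \<noteq> []"
    and bad: "real (card {q \<in> {..<n} - R. worth (\<mu> q) gs < 1 - \<epsilon> / 2}) \<le> \<epsilon> * real n / 2"
  shows "achieves \<mu> (completion n R \<epsilon> gs)
     (n * length gs + nat \<lceil>log 2 (real n)\<rceil> * n * Suc (length gs)) 0
     (\<lambda>Y. (\<forall>q. \<Union>(Y q) \<subseteq> \<Union>(pieces gs)) \<and> (\<forall>q q'. q \<noteq> q' \<longrightarrow> \<Union>(Y q) \<inter> \<Union>(Y q') = {}) \<and>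
        completed_fairly n R \<epsilon> \<mu> Y)"
proof -
  define rest where "rest = filter (\<lambda>q. q \<notin> R) [0..<n]"
  define good where "good = filter (\<lambda>q. 1 - \<epsilon> / 2 \<le> worth (\<mu> q) gs) rest"
  define f where "f = nat \<lfloor>\<epsilon> * real n\<rfloor>"
  define k where "k = n - card R - f"
  define qs where "qs = take k good"
  define d where "d = nat \<lceil>log 2 (real n)\<rceil>"
  let ?bad = "{q \<in> {..<n} - R. worth (\<mu> q) gs < 1 - \<epsilon> / 2}"
  have n0: "0 < n" using \<epsilon> by (cases n) auto
  have finR: "finite R" using R finite_subset by blast
  have set_rest: "set rest = {..<n} - R" by (auto simp: rest_def)
  have dist: "distinct good" "distinct qs" by (auto simp: good_def rest_def qs_def)
  \<comment> \<open>Rounding down costs at most half of a number that is at least 1.\<close>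
  have f: "\<epsilon> * real n \<le> 2 * real f" "real f \<le> \<epsilon> * real n"
  proof -
    have "real f = of_int \<lfloor>\<epsilon> * real n\<rfloor>" using \<epsilon> by (simp add: f_def)
    moreover have "1 \<le> \<lfloor>\<epsilon> * real n\<rfloor>" using \<epsilon> by simp
    ultimately show "\<epsilon> * real n \<le> 2 * real f" "real f \<le> \<epsilon> * real n" by linarith+
  qed
  have "length good = card (set good)" using dist by (simp add: distinct_card)
  also have "set good = ({..<n} - R) - ?bad" by (auto simp: good_def set_rest)
  also have "card \<dots> = card ({..<n} - R) - card ?bad" by (rule card_Diff_subset) auto
  also have "card ({..<n} - R) = n - card R" using R finR by (simp add: card_Diff_subset)
  finally have len_good: "length good = n - card R - card ?bad" .
  have "card ?bad \<le> f" using bad f by linarith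
  then have len_qs: "length qs = k" using len_good by (simp add: qs_def k_def)
  have kn: "real k / real n \<le> 1 - \<epsilon> / 2"
  proof -
    have "real k \<le> (1 - \<epsilon> / 2) * real n"
    proof (cases "k = 0")
      case False
      then have "real k = real n - real (card R) - real f" by (simp add: k_def)
      then show ?thesis using f by (simp add: algebra_simps)
    qed (use \<epsilon> in simp)
    then show ?thesis using n0 by (simp add: divide_le_eq)
  qed
  have qs: "q \<in> {..<n} - R \<and> 1 - \<epsilon> / 2 \<le> worth (\<mu> q) gs" if "q \<in> set qs" for q
    using in_set_takeD[OF that[unfolded qs_def]] set_rest by (auto simp: good_def)
  have "real n = 2 powr (log 2 (real n))" using n0 by simp
  also have "\<dots> \<le> 2 powr real d"
    unfolding d_def by (intro powr_mono real_nat_ceiling_ge) auto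
  finally have nd: "n \<le> 2 ^ d" by (simp add: powr_realpow)
  have EP: "achieves \<mu> (even_paz n d qs gs) (d * length qs * Suc (length gs)) 0
      (divides n \<mu> qs (\<Union>(pieces gs)))"
  proof (rule achieves_even_paz)
    show "length qs \<le> 2 ^ d" using nd len_qs by (simp add: k_def)
  qed (use gs dist qs vf kn len_qs in force)+
  have completed: "completed_fairly n R \<epsilon> \<mu> Y" if "divides n \<mu> qs (\<Union>(pieces gs)) Y" for Y
    unfolding completed_fairly_def
  proof (intro exI conjI)
    show "{..<n} - R - set qs \<subseteq> {..<n} - R" by auto
    have "card ({..<n} - R - set qs) = n - card R - k"
      using qs R finR dist(2) len_qs by (subst card_Diff_subset) (auto simp: card_Diff_subset distinct_card)
    \<comment> \<open>Truncated subtraction is harmless: if f exceeds n - card R, then k = 0 and all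
      the others are victims, fewer than f.\<close>
    also have "\<dots> \<le> f" by (simp add: k_def)
    finally show "real (card ({..<n} - R - set qs)) \<le> \<epsilon> * real n" using f by linarith
    show "\<forall>p\<in>{..<n} - R - ({..<n} - R - set qs). fair_portion n (\<mu> p) (Y p)"
      using that by (auto simp: divides_def)
  qed
  have "achieves \<mu> (completion n R \<epsilon> gs) (length rest * length gs + d * length qs * Suc (length gs)) 0
     (divides n \<mu> qs (\<Union>(pieces gs)))"
    unfolding completion_def rest_def[symmetric] d_def[symmetric]
    by (rule achieves_bind0[OF achieves_contented[OF gs(1)]])
      (use EP in \<open>simp_all add: qs_def k_def f_def good_def\<close>)
  then show ?thesis unfolding d_def[symmetric]
  proof (rule achieves_weaken)
    have "length rest \<le> n" using length_filter_le[of _ "[0..<n]"] by (simp add: rest_def)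
    moreover have "length qs \<le> n" using len_qs by (simp add: k_def)
    ultimately show "length rest * length gs + d * length qs * Suc (length gs)
        \<le> n * length gs + d * n * Suc (length gs)"
      by (intro add_mono mult_le_mono) auto
  qed (use completed in \<open>auto simp: divides_def\<close>)
qed

text \<open>The completion part must succeed almost surely, so the whole error comes from the
  preassigning part.\<close>

lemma run_two_part_ge:
  assumes A: "achieves \<mu> A c \<delta> P"
    and B: "\<And>X B. P (X, B) \<Longrightarrow> achieves \<mu> B c' 0 (Q X)"
    and S: "\<And>X B q Y q'. P (X, B) \<Longrightarrow> q \<le> c \<Longrightarrow> Q X Y \<Longrightarrow> q' \<le> c' \<Longrightarrow> (X, q, Y, q') \<in> S"
  shows "1 - \<delta> \<le> measure_pmf.prob (run_two_part \<mu> A) S"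
proof -
  have "measure_pmf.prob (run_two_part \<mu> A) (- S) \<le> \<delta> + 0"
    unfolding run_two_part_def
  proof (rule prob_bind_pmf_le)
    show "measure_pmf.prob (run \<mu> A) {x. \<not> (P (fst x) \<and> snd x \<le> c)} \<le> \<delta>"
      using A by (simp add: achieves_def case_prod_unfold)
    fix x assume x: "P (fst x) \<and> snd x \<le> c"
    obtain X B q where X: "x = ((X, B), q)" by (metis prod.exhaust)
    have "measure_pmf.prob (run \<mu> B) ((\<lambda>(Y, q'). (X, q, Y, q')) -` (- S))
        \<le> measure_pmf.prob (run \<mu> B) {(Y, q'). \<not> (Q X Y \<and> q' \<le> c')}"
      using x X S[of X B q] by (intro measure_pmf.finite_measure_mono) auto
    also have "\<dots> \<le> 0" using B[of X B] x X by (simp add: achieves_def)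
    finally show "measure_pmf.prob (case x of (x, xa) \<Rightarrow> (case x of (X, B) \<Rightarrow>
        \<lambda>q. map_pmf (\<lambda>(Y, q'). (X, q, Y, q')) (run \<mu> B)) xa) (- S) \<le> 0"
      by (simp add: X)
  qed simp
  moreover have "measure_pmf.prob (run_two_part \<mu> A) (- S) = 1 - measure_pmf.prob (run_two_part \<mu> A) S"
    using measure_pmf.prob_compl[of S "run_two_part \<mu> A"] by (simp add: Compl_eq_Diff_UNIV)
  ultimately show ?thesis by simp
qed

section \<open>Numbers of halvings and samples, and their estimates\<close>

definition rounds :: "real \<Rightarrow> nat" where
  "rounds \<rho> = nat \<lceil>32 * ln (1 / \<rho>)\<rceil>"

text \<open>1920 = 16 * 12 * 10: the 16 and the number of rounds come from \<eta>, the 12 from the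
  exponent in \<open>achieves_halve\<close>, and the 10 makes one vote fail with probability at most
  exp (- 10 * t * L).\<close>

definition sample_size :: "real \<Rightarrow> real \<Rightarrow> nat" where
  "sample_size t \<rho> = nat \<lceil>1920 * t * ln (1 / \<rho>) * real (rounds \<rho>) / \<rho>\<rceil>"

text \<open>
  Starting the truncation at \<open>16 / \<rho>\<close>, far above every value, makes the initial truncated mean at
  most \<open>\<rho> / 16\<close>, and it stays of this order while the truncation level falls to \<open>\<rho> / 4\<close>.
\<close>

definition divide_cake :: "nat \<Rightarrow> real \<Rightarrow> real \<Rightarrow> nat set \<Rightarrow> two_part_algorithm" where
  "divide_cake n \<epsilon> t R =
     (let r = real (card R); \<rho> = \<epsilon> / r in
      rw_bind (preassign (mixture n R) (sample_size t \<rho>) (rounds \<rho>) (16 / \<rho>) (1 / (2 * r))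
          (sorted_list_of_set R) [(0, 1)] (\<lambda>_. {}))
        (\<lambda>(X, gs). Return (X, completion n R \<epsilon> gs)))"

locale parameters =
  fixes n :: nat and \<epsilon> t :: real and R :: "nat set" and r :: nat
  assumes \<epsilon>: "0 < \<epsilon>" "\<epsilon> \<le> 1 / exp 1" and t: "1 \<le> t"
    and R: "R \<subseteq> {..<n}" "card R = r" "1 \<le> r"
    and few: "real r \<le> \<epsilon> * exp (sqrt (ln (real n)) / 7)"
begin

definition "\<rho> = \<epsilon> / real r"
definition "L = ln (real r / \<epsilon>)"
definition "k = rounds \<rho>"
definition "s = sample_size t \<rho>"
text \<open>All halvings together then add k * 4/3 * \<eta> = \<rho> / 12 to the mean, comparable to
  the initial \<rho> / 16; the sum is 7 / 48 * \<rho>.\<close>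

definition "\<eta> = \<rho> / (16 * real k)"

lemma ln_inverse_\<rho>: "ln (1 / \<rho>) = L" by (simp add: \<rho>_def L_def)

lemma \<epsilon>_le: "\<epsilon> \<le> 1 / 2"
proof -
  have "1 / exp 1 \<le> 1 / (2::real)" using exp_ge_add_one_self[of "1::real"] by (intro divide_left_mono) auto
  then show ?thesis using \<epsilon> by linarith
qed

lemma exp_L: "exp L = real r / \<epsilon>" using \<epsilon> R by (simp add: L_def)

lemma \<rho>_eq: "\<rho> = exp (- L)" by (simp add: exp_minus exp_L \<rho>_def)

lemma \<rho>_pos: "0 < \<rho>" by (simp add: \<rho>_eq)

lemma L_ge_1: "1 \<le> L"
proof -
  have "exp 1 * \<epsilon> \<le> 1" using \<epsilon>(2) by (simp add: field_simps)
  then have "exp 1 \<le> 1 / \<epsilon>" using \<epsilon> by (simp add: field_simps)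
  also have "\<dots> \<le> real r / \<epsilon>" using R \<epsilon> by (intro divide_right_mono) auto
  finally show ?thesis using exp_L by (metis exp_le_cancel_iff)
qed

lemma two_le_exp_L: "2 \<le> exp L" using exp_ge_add_one_self[of L] L_ge_1 by linarith

lemma n_pos: "0 < n" using R by (cases n) auto

text \<open>Squaring 7 * L \<le> sqrt (ln n) even gives 49 * L ^ 2; the linear form suffices because
  k is linear in L.\<close>

lemma exp_le_n: "exp (49 * L) \<le> real n"
proof -
  have "exp L \<le> exp (sqrt (ln (real n)) / 7)"
    using few \<epsilon> by (simp add: exp_L divide_le_eq mult.commute)
  then have "7 * L \<le> sqrt (ln (real n))" by simp
  then have "(7 * L)\<^sup>2 \<le> (sqrt (ln (real n)))\<^sup>2" using L_ge_1 by (intro power_mono) auto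
  also have "\<dots> = ln (real n)" using n_pos by simp
  finally have "49 * (L * L) \<le> ln (real n)" by (simp add: power2_eq_square)
  moreover have "L * 1 \<le> L * L" using L_ge_1 by (intro mult_left_mono) auto
  ultimately have "49 * L \<le> ln (real n)" by simp
  then show ?thesis using n_pos by (simp add: ln_ge_iff)
qed

lemma k_bounds: "32 * L \<le> real k" "real k \<le> 33 * L" "0 < k"
proof -
  have "real k = of_int \<lceil>32 * L\<rceil>" using L_ge_1 by (simp add: k_def rounds_def ln_inverse_\<rho>)
  then show "32 * L \<le> real k" "real k \<le> 33 * L" using L_ge_1 by linarith+
  then show "0 < k" using L_ge_1 by (cases k) auto
qed

lemma r_le_exp_L: "real r \<le> exp L"
  using \<epsilon> \<epsilon>_le R by (simp add: exp_L le_divide_eq mult_left_le)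

lemma one_le_tL2: "1 \<le> t * L\<^sup>2"
  using mult_mono[of 1 t 1 "L\<^sup>2"] t L_ge_1 by (simp add: one_le_power)

text \<open>Absorbs additive constants, such as those from rounding up, into multiples of t * L ^ 2
  / \<rho>.\<close>

lemma one_le_scale: "1 \<le> t * L\<^sup>2 / \<rho>"
proof -
  have "\<rho> \<le> 1" using L_ge_1 by (simp add: \<rho>_eq)
  then show ?thesis using one_le_tL2 \<rho>_pos by simp
qed

lemma s_bounds: "1920 * t * L * real k / \<rho> \<le> real s" "real s \<le> 63361 * (t * L\<^sup>2 / \<rho>)"
proof -
  let ?x = "1920 * t * L * real k / \<rho>"
  have x0: "0 \<le> ?x" using t L_ge_1 \<rho>_pos by simp
  have "real s = of_int \<lceil>?x\<rceil>"
    using x0 by (simp add: s_def sample_size_def ln_inverse_\<rho> k_def[symmetric])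
  then have s: "?x \<le> real s" "real s \<le> ?x + 1" by linarith+
  then show "?x \<le> real s" by simp
  have "1 \<le> t * L\<^sup>2 / \<rho>" by (rule one_le_scale)
  moreover have "?x \<le> 1920 * t * L * (33 * L) / \<rho>"
    using k_bounds t L_ge_1 \<rho>_pos by (intro divide_right_mono mult_left_mono) auto
  then have "?x \<le> 63360 * (t * L\<^sup>2 / \<rho>)" by (simp add: power2_eq_square mult_ac)
  ultimately show "real s \<le> 63361 * (t * L\<^sup>2 / \<rho>)" using s by linarith
qed

text \<open>The union bound over r * k votes costs a factor of at most exp (8 * L), since r \<le>
  exp L and k \<le> exp (7 * L); the exponent 10 * t * L of a single vote leaves more than t * L
  after that.\<close>

lemma failure_bound: "real r * (real k * exp (- \<eta> / 12 * real s)) \<le> (\<epsilon> / real r) powr t"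
proof -
  have "10 * t * L = \<eta> / 12 * (1920 * t * L * real k / \<rho>)"
    using \<rho>_pos k_bounds(3) by (simp add: \<eta>_def field_simps)
  also have "\<dots> \<le> \<eta> / 12 * real s"
    using s_bounds(1) \<rho>_pos by (intro mult_left_mono) (auto simp: \<eta>_def)
  finally have e: "exp (- \<eta> / 12 * real s) \<le> exp (- 10 * t * L)" by simp
  have "2 ^ 6 \<le> exp L ^ 6" using two_le_exp_L by (intro power_mono) auto
  then have "64 * (1 + L) \<le> exp L ^ 6 * exp L"
    using exp_ge_add_one_self[of L] L_ge_1 by (intro mult_mono) auto
  also have "\<dots> = exp (7 * L)" by (simp flip: exp_of_nat_mult exp_add)
  finally have "64 * (1 + L) \<le> exp (7 * L)" .
  moreover have "real k \<le> 64 * (1 + L)" using k_bounds(2) L_ge_1 unfolding distrib_left by linarith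
  ultimately have k: "real k \<le> exp (7 * L)" by (rule order.trans[rotated])
  have "real r * (real k * exp (- \<eta> / 12 * real s)) \<le> exp L * (exp (7 * L) * exp (- 10 * t * L))"
    using r_le_exp_L k e by (intro mult_mono) auto
  also have "\<dots> = exp (8 * L - 10 * (t * L))" by (simp flip: exp_add)
  also have "\<dots> \<le> exp (- (t * L))"
  proof -
    have "1 * L \<le> t * L" using t L_ge_1 by (intro mult_right_mono) auto
    then show ?thesis using L_ge_1 by simp
  qed
  also have "\<dots> = \<rho> powr t" using \<rho>_pos by (simp add: powr_def \<rho>_eq)
  finally show ?thesis by (simp add: \<rho>_def)
qed

text \<open>As 3/4 \<le> exp (- 1 / 4), the 32 * L halvings lower the level by exp (8 * L): 2 * L
  leads from 1 / \<rho> to \<rho>, and 6 * L pays for the factor 64 = 2 ^ 6 between the constants 16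
  and 1/4.\<close>

lemma final_truncation: "(3 / 4) ^ k * (16 / \<rho>) \<le> \<rho> / 4"
proof -
  have "(3 / 4) ^ k \<le> exp (- 1 / 4 :: real) ^ k"
    using exp_ge_add_one_self[of "- 1 / 4 :: real"] by (intro power_mono) auto
  also have "\<dots> = exp (- real k / 4)" by (simp flip: exp_of_nat_mult)
  also have "\<dots> \<le> exp (- 8 * L)" using k_bounds by simp
  finally have "(3 / 4) ^ k * (16 / \<rho>) \<le> exp (- 8 * L) * (16 / \<rho>)"
    using \<rho>_pos by (intro mult_right_mono) auto
  also have "\<dots> = 16 * (exp (- 8 * L) * exp L)" by (simp add: \<rho>_eq exp_minus divide_inverse)
  also have "\<dots> = 16 * exp (- 7 * L)" by (simp flip: exp_add)
  also have "\<dots> \<le> exp (6 * L) / 4 * exp (- 7 * L)"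
  proof -
    have "2 ^ 6 \<le> exp L ^ 6" using two_le_exp_L by (intro power_mono) auto
    also have "\<dots> = exp (6 * L)" by (simp flip: exp_of_nat_mult)
    finally show ?thesis by (intro mult_right_mono) auto
  qed
  also have "\<dots> = exp (- L) / 4" by (simp flip: exp_add)
  finally show ?thesis by (simp add: \<rho>_eq)
qed

text \<open>The factors 2, r and 2 ^ k cost exponents of at most L, L and 33 * L, well below the
  available 49 * L.\<close>

lemma preassigned_value: "1 / real n \<le> 1 / (2 * real r) / 2 ^ k"
proof -
  have "(2::real) ^ k \<le> exp 1 ^ k"
    using exp_ge_add_one_self[of "1::real"] by (intro power_mono) auto
  then have "2 ^ k \<le> exp (real k)" by (simp flip: exp_of_nat_mult)
  then have "2 * real r * 2 ^ k \<le> exp L * exp L * exp (real k)"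
    using r_le_exp_L two_le_exp_L by (intro mult_mono) auto
  also have "\<dots> = exp (L + L + real k)" by (simp flip: exp_add)
  also have "\<dots> \<le> exp (49 * L)" using k_bounds L_ge_1 by simp
  also have "\<dots> \<le> real n" by (rule exp_le_n)
  finally show ?thesis using R by (simp add: divide_divide_eq_left frac_le)
qed

lemma mean_bound: "1 / (16 / \<rho>) + real k * (4 / 3 * \<eta>) = 7 / 48 * \<rho>"
  using k_bounds(3) by (simp add: \<eta>_def field_simps)

lemma \<epsilon>n_ge_1: "1 \<le> \<epsilon> * real n"
proof -
  have "1 / \<epsilon> \<le> exp L" using R \<epsilon> by (simp add: exp_L divide_right_mono)
  also have "\<dots> \<le> exp (49 * L)" using L_ge_1 by simp
  finally have "1 / \<epsilon> \<le> real n" using exp_le_n by linarith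
  then show ?thesis using \<epsilon> by (simp add: field_simps)
qed

text \<open>For each player the k halvings of 2 * s + 1 queries, of order L * t * L ^ 2 / \<rho>,
  dominate the search for a gap, because r \<le> exp L = 1 / \<rho>. The constants are 126723 = 2 *
  63361 + 1 and 4181859 = 33 * 126723.\<close>

lemma preassigning_cost:
  "real (r * (r + k * Suc (2 * s))) \<le> 5000000 * (t * real r ^ 2 / \<epsilon> * ln (real r / \<epsilon>) ^ 3)"
proof -
  let ?y = "t * L\<^sup>2 / \<rho>"
  define z where "z = L * ?y"
  have "real (Suc (2 * s)) = 1 + 2 * real s" by simp
  then have "real (Suc (2 * s)) \<le> 126723 * ?y" using s_bounds(2) one_le_scale by linarith
  then have "real k * real (Suc (2 * s)) \<le> (33 * L) * (126723 * ?y)"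
    using k_bounds L_ge_1 by (intro mult_mono) auto
  then have "real k * real (Suc (2 * s)) \<le> 4181859 * z" by (simp only: z_def)
  moreover have "real r \<le> z"
  proof -
    have "1 / \<rho> = exp L" by (simp add: \<rho>_eq exp_minus divide_inverse)
    then have "real r \<le> 1 * (1 * (1 / \<rho>))" using r_le_exp_L by simp
    also have "\<dots> \<le> L * (t * L\<^sup>2 * (1 / \<rho>))"
      using one_le_tL2 L_ge_1 \<rho>_pos by (intro mult_mono) auto
    finally show ?thesis by (simp add: z_def)
  qed
  ultimately have "real r + real k * real (Suc (2 * s)) \<le> 5000000 * z" by linarith
  then have "real r + real k * real (Suc (2 * s)) \<le> 5000000 * (L * ?y)" by (simp only: z_def)
  then have "real r * (real r + real k * real (Suc (2 * s))) \<le> real r * (5000000 * (L * ?y))"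
    by (intro mult_left_mono) auto
  also have "\<dots> = 5000000 * (t * real r ^ 2 / \<epsilon> * ln (real r / \<epsilon>) ^ 3)"
    by (simp add: L_def[symmetric] \<rho>_def power2_eq_square power3_eq_cube)
  finally show ?thesis by (simp only: of_nat_add of_nat_mult)
qed

text \<open>11 = 2 + 9: appraising uses r + 1 \<le> 2 * r, and the division has at most 3 * ln n
  levels with r + 2 \<le> 3 * r.\<close>

lemma completion_cost:
  "real (n * Suc r + nat \<lceil>log 2 (real n)\<rceil> * n * Suc (Suc r))
     \<le> 11 * (real r * real n * ln (real r * real n))"
proof -
  let ?l = "ln (real n)"
  have l1: "1 \<le> ?l" 
  proof -
    have "49 * L \<le> ?l" using exp_le_n n_pos by (simp add: ln_ge_iff)
    then show ?thesis using L_ge_1 by linarith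
  qed
  have "log 2 (real n) = ?l / ln 2" by (simp add: log_def)
  also have "\<dots> \<le> ?l / (1 / 2)" using ln2_ge_two_thirds l1 by (intro divide_left_mono) auto
  finally have "log 2 (real n) \<le> 2 * ?l" by simp
  moreover have "0 \<le> log 2 (real n)" using n_pos by simp
  ultimately have d: "real (nat \<lceil>log 2 (real n)\<rceil>) \<le> 3 * ?l" using l1 by linarith
  have r: "real (Suc r) \<le> 2 * real r" "real (Suc (Suc r)) \<le> 3 * real r" using R by auto
  have "real (n * Suc r) \<le> 2 * (real r * real n * 1)" 
    unfolding of_nat_mult using mult_left_mono[OF r(1), of "real n"] by (simp add: mult_ac del: of_nat_Suc)
  also have "\<dots> \<le> 2 * (real r * real n * ?l)" using l1 by (intro mult_left_mono) auto
  finally have 1: "real (n * Suc r) \<le> 2 * (real r * real n * ?l)" .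
  have "real (nat \<lceil>log 2 (real n)\<rceil> * n * Suc (Suc r)) \<le> 3 * ?l * real n * (3 * real r)"
    unfolding of_nat_mult using d r l1 by (intro mult_mono) auto
  then have "real (n * Suc r + nat \<lceil>log 2 (real n)\<rceil> * n * Suc (Suc r)) \<le> 11 * (real r * real n * ?l)"
    using 1 by (simp add: algebra_simps)
  also have "\<dots> \<le> 11 * (real r * real n * ln (real r * real n))"
    using R n_pos by (intro mult_left_mono ln_mono) auto
  finally show ?thesis .
qed

lemma error_le: "(\<epsilon> / real r) powr t \<le> exp (- t)"
proof -
  have "(\<epsilon> / real r) powr t = exp (- (t * L))"
    using \<rho>_pos by (simp add: \<rho>_def[symmetric] powr_def \<rho>_eq)
  also have "t * 1 \<le> t * L" using t L_ge_1 by (intro mult_left_mono) auto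
  then have "exp (- (t * L)) \<le> exp (- t)" by simp
  finally show ?thesis .
qed

section \<open>Correctness for given value functions\<close>

context
  fixes \<mu> :: "nat \<Rightarrow> real set \<Rightarrow> real"
  assumes vf: "\<forall>p<n. value_function (\<mu> p)"
begin

lemma ne: "R \<noteq> {}" using R by auto

interpretation sampling "mixture n R" \<mu>
  using set_pmf_mixture[OF R(1) ne] vf finite_subset by unfold_locales auto

lemma divide_cake_correct:
  "1 - (\<epsilon> / real r) powr t \<le> measure_pmf.prob (run_two_part \<mu> (divide_cake n \<epsilon> t R))
     {(X, q, Y, q'). preassigned_fairly n R \<mu> X \<and>
        real q \<le> 5000000 * (t * real r ^ 2 / \<epsilon> * ln (real r / \<epsilon>) ^ 3) \<and>
        completed_fairly n R \<epsilon> \<mu> Y \<and>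
        real q' \<le> 11 * (real r * real n * ln (real r * real n)) \<and>
        disjoint_portions n R X Y}"
proof -
  let ?\<sigma> = "(3 / 4) ^ k * (16 / \<rho>)"
  let ?inv = "preassigned R (1 / (2 * real r) / 2 ^ k) ?\<sigma> (7 / 48 * \<rho>)"
  have finR: "finite R" using R(1) finite_subset by blast
  have vfR: "value_function (\<mu> p)" if "p \<in> R" for p using that R(1) vf by auto
  have \<sigma>: "0 < ?\<sigma>" "?\<sigma> \<le> \<rho> / 4" using \<rho>_pos final_truncation by auto
  have r\<rho>: "real r * \<rho> = \<epsilon>" using R by (simp add: \<rho>_def)
  have init: "?inv {} (\<lambda>_. {}, [(0, 1)])"
  proof -
    have "E (\<lambda>q. min ((1 - worth (\<mu> q) [(0, 1)]) / ?\<sigma>) 1) \<le> E (\<lambda>_. 0)"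
      by (rule E_mono) (use value_D in \<open>auto simp: value_function_def\<close>)
    then show ?thesis using vfR
      by (auto simp: preassigned_def disjoint_family_on_def value_function_def)
  qed
  have mass: "7 / 48 * \<rho> < pmf (mixture n R) q" if "q \<in> R" for q
  proof -
    have "7 / 48 * \<rho> < 1 / (2 * real r)" using \<epsilon> \<epsilon>_le R by (simp add: \<rho>_def field_simps)
    also have "\<dots> \<le> pmf (mixture n R) q" using that by (simp add: pmf_mixture[OF R(1) ne] R(2))
    finally show ?thesis .
  qed
  \<comment> \<open>The first summand is 1/2, the second at most \<epsilon> / 4.\<close>
  have room: "real (card R) * (1 / (2 * real r)) + real (card R) * ?\<sigma> \<le> 1"
  proof -
    have "real r * ?\<sigma> \<le> real r * (\<rho> / 4)" using \<sigma>(2) by (intro mult_left_mono) auto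
    then show ?thesis using r\<rho> \<epsilon>_le R by (simp del: mult_le_cancel_left_pos)
  qed
  have pre: "achieves \<mu> (preassign (mixture n R) s k (16 / \<rho>) (1 / (2 * real r))
        (sorted_list_of_set R) [(0, 1)] (\<lambda>_. {})) (r * (r + k * Suc (2 * s)))
      ((\<epsilon> / real r) powr t) (?inv R)"
  proof -
    have "achieves \<mu> (preassign (mixture n R) s k (16 / \<rho>) (1 / (2 * real r))
        (sorted_list_of_set R) [(0, 1)] (\<lambda>_. {}))
      (length (sorted_list_of_set R) * (card R + k * Suc (2 * s)))
      (real (length (sorted_list_of_set R)) * (real k * exp (- \<eta> / 12 * real s))) (?inv R)"
      using achieves_preassign[where \<tau> = "16 / \<rho>" and \<eta> = \<eta> and R = R and k = k and S = "{}" and s = s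
          and \<beta> = "1 / (2 * real r)" and gs = "[(0, 1)]" and X = "\<lambda>_. {}" and ps = "sorted_list_of_set R",
          unfolded mean_bound, OF finR vfR mass _ _ _ room init]
        \<rho>_pos finR by (simp add: \<eta>_def)
    then show ?thesis using failure_bound R finR by (elim achieves_weaken) auto
  qed
  define P where "P = (\<lambda>(X, B). \<exists>gs. ?inv R (X, gs) \<and> B = completion n R \<epsilon> gs)"
  have "achieves \<mu> (divide_cake n \<epsilon> t R) (r * (r + k * Suc (2 * s)) + 0) ((\<epsilon> / real r) powr t + 0) P"
    unfolding divide_cake_def Let_def R(2) \<rho>_def[symmetric] s_def[symmetric] k_def[symmetric]
    by (rule achieves_bind[OF pre[folded \<rho>_def]]) (auto simp: P_def intro!: achieves_Return)
  then have A: "achieves \<mu> (divide_cake n \<epsilon> t R) (r * (r + k * Suc (2 * s))) ((\<epsilon> / real r) powr t) P"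
    by simp
  define Q where "Q X Y \<longleftrightarrow> completed_fairly n R \<epsilon> \<mu> Y \<and> disjoint_portions n R X Y" for X Y
  show ?thesis
  proof (rule run_two_part_ge[OF A, where Q = Q and c' = "n * Suc r + nat \<lceil>log 2 (real n)\<rceil> * n * Suc (Suc r)"])
    fix X B assume "P (X, B)"
    then obtain gs where inv: "?inv R (X, gs)" and B: "B = completion n R \<epsilon> gs" by (auto simp: P_def)
    let ?bad = "{q \<in> {..<n} - R. worth (\<mu> q) gs < 1 - \<epsilon> / 2}"
    have gs: "gaps 0 gs" "length gs = Suc r" "gs \<noteq> []"
      and mean: "E (\<lambda>q. min ((1 - worth (\<mu> q) gs) / ?\<sigma>) 1) \<le> real r * (7 / 48 * \<rho>)"
      and XR: "\<And>p. p \<in> R \<Longrightarrow> \<Union>(X p) \<inter> \<Union>(pieces gs) = {}" "disjoint_family_on (\<lambda>p. \<Union>(X p)) R"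
      using inv R(2) by (auto simp: preassigned_def)
    have "\<rho> \<le> \<epsilon>" using R \<epsilon> by (simp add: \<rho>_def divide_le_eq)
    then have "?\<sigma> \<le> \<epsilon> / 2" using \<sigma>(2) \<epsilon> by linarith
    \<comment> \<open>Each bad player has probability at least 1 / (2 * n) and contributes a full 1
      to the mean, as her loss exceeds \<epsilon> / 2 and thus the truncation level. A mean of at
      most 7 / 48 * \<epsilon> leaves at most 7 / 24 * \<epsilon> * n of them.\<close>
    have "real (card ?bad) * (1 / (2 * real n)) \<le> (\<Sum>q\<in>?bad. pmf (mixture n R) q)"
      by (rule sum_bounded_below) (simp add: pmf_mixture[OF R(1) ne])
    also have "\<dots> = E (indicator ?bad)"
      by (simp add: measure_measure_pmf_finite)
    also have "\<dots> \<le> E (\<lambda>q. min ((1 - worth (\<mu> q) gs) / ?\<sigma>) 1)"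
    proof (rule E_mono)
      fix q assume q: "q \<in> set_pmf (mixture n R)"
      have "worth (\<mu> q) gs \<le> 1"
        using worth_le[OF value_D[OF q] gs(1)] value_D[OF q] by (simp add: value_function_def)
      moreover have "1 \<le> (1 - worth (\<mu> q) gs) / ?\<sigma>" if "q \<in> ?bad"
      proof -
        have "?\<sigma> \<le> 1 - worth (\<mu> q) gs" using that \<open>?\<sigma> \<le> \<epsilon> / 2\<close> by auto
        then show ?thesis using \<sigma>(1) by (simp only: le_divide_eq_1_pos)
      qed
      moreover from calculation have "0 \<le> (1 - worth (\<mu> q) gs) / ?\<sigma>"
        using \<sigma>(1) by (intro divide_nonneg_pos) simp_all
      ultimately show "indicator ?bad q \<le> min ((1 - worth (\<mu> q) gs) / ?\<sigma>) 1"
        by (cases "q \<in> ?bad")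
          (simp_all only: indicator_simps min.bounded_iff order.refl zero_le_one simp_thms)
    qed
    also have "\<dots> \<le> 7 / 48 * \<epsilon>" using mean r\<rho> by (simp add: mult.left_commute)
    finally have "real (card ?bad) \<le> 7 / 48 * \<epsilon> * (2 * real n)" using n_pos by (simp add: field_simps)
    also have "\<dots> \<le> \<epsilon> * real n / 2" using \<epsilon> by simp
    finally have bad: "real (card ?bad) \<le> \<epsilon> * real n / 2" .
    have vf': "value_function (\<mu> q)" if "q < n" for q using vf that by auto
    have \<epsilon>1: "\<epsilon> \<le> 1" using \<epsilon>_le by simp
    show "achieves \<mu> B (n * Suc r + nat \<lceil>log 2 (real n)\<rceil> * n * Suc (Suc r)) 0 (Q X)"
      unfolding B
    proof (rule achieves_weaken[OF achieves_completion[OF vf' R(1) \<epsilon>(1) \<epsilon>1 \<epsilon>n_ge_1 gs(1,3) bad]])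
      fix Y
      assume Y: "(\<forall>q. \<Union> (Y q) \<subseteq> \<Union> (pieces gs)) \<and>
         (\<forall>q q'. q \<noteq> q' \<longrightarrow> \<Union> (Y q) \<inter> \<Union> (Y q') = {}) \<and> completed_fairly n R \<epsilon> \<mu> Y"
      have "\<Union>(if p \<in> R then X p else Y p) \<inter> \<Union>(if p' \<in> R then X p' else Y p') = {}"
        if "p \<noteq> p'" for p p'
      proof -
        have "\<Union>(X p) \<inter> \<Union>(X p') = {}" if "p \<in> R" "p' \<in> R"
          using XR(2) that \<open>p \<noteq> p'\<close> by (simp add: disjoint_family_on_def)
        moreover have "\<Union>(X a) \<inter> \<Union>(Y b) = {}" if "a \<in> R" for a b
          using XR(1)[OF that] Y by blast
        moreover have "\<Union>(Y p) \<inter> \<Union>(Y p') = {}" using Y that by blast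
        ultimately show ?thesis by (cases "p \<in> R"; cases "p' \<in> R") (simp_all add: Int_commute)
      qed
      then show "Q X Y" using Y by (simp add: Q_def disjoint_portions_def disjoint_family_on_def)
    qed (use gs in auto)
  next
    fix X B q Y q'
    assume P: "P (X, B)" and q: "q \<le> r * (r + k * Suc (2 * s))" and Q: "Q X Y"
      and q': "q' \<le> n * Suc r + nat \<lceil>log 2 (real n)\<rceil> * n * Suc (Suc r)"
    have "preassigned_fairly n R \<mu> X"
      unfolding preassigned_fairly_def fair_portion_def
      using P preassigned_value by (fastforce simp: P_def preassigned_def)
    moreover have "real q \<le> 5000000 * (t * real r ^ 2 / \<epsilon> * ln (real r / \<epsilon>) ^ 3)"
      using preassigning_cost q by (meson of_nat_le_iff order.trans)
    moreover have "real q' \<le> 11 * (real r * real n * ln (real r * real n))"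
      using completion_cost q' by (meson of_nat_le_iff order.trans)
    ultimately show "(X, q, Y, q') \<in> {(X, q, Y, q'). preassigned_fairly n R \<mu> X \<and>
        real q \<le> 5000000 * (t * real r ^ 2 / \<epsilon> * ln (real r / \<epsilon>) ^ 3) \<and>
        completed_fairly n R \<epsilon> \<mu> Y \<and>
        real q' \<le> 11 * (real r * real n * ln (real r * real n)) \<and>
        disjoint_portions n R X Y}"
      using Q by (simp add: Q_def)
  qed
qed

end

end

theorem theorem2:
  "\<exists>(A :: nat \<Rightarrow> real \<Rightarrow> real \<Rightarrow> nat set \<Rightarrow> two_part_algorithm) (c\<^sub>1 :: real) (c\<^sub>2 :: real).
     \<forall>(n :: nat) (\<epsilon> :: real) (t :: real) (R :: nat set) (r :: nat).
       0 < \<epsilon> \<and> \<epsilon> \<le> 1 / exp 1 \<and> 1 \<le> t \<and>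
       R \<subseteq> {..<n} \<and> card R = r \<and> 1 \<le> r \<and>
       real r \<le> \<epsilon> * exp (sqrt (ln (real n)) / 7)
       \<longrightarrow>
       (\<forall>\<mu> :: nat \<Rightarrow> real set \<Rightarrow> real. (\<forall>p<n. value_function (\<mu> p)) \<longrightarrow>
          measure_pmf.prob (run_two_part \<mu> (A n \<epsilon> t R))
            {(X, q, Y, q').
               preassigned_fairly n R \<mu> X \<and>
               real q \<le> c\<^sub>1 * (t * real r ^ 2 / \<epsilon> * ln (real r / \<epsilon>) ^ 3) \<and>
               completed_fairly n R \<epsilon> \<mu> Y \<and>
               real q' \<le> c\<^sub>2 * (real r * real n * ln (real r * real n)) \<and>
               disjoint_portions n R X Y}
          \<ge> 1 - (\<epsilon> / real r) powr t) \<and>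
       1 - (\<epsilon> / real r) powr t \<ge> 1 - exp (- t)"
proof (intro exI allI impI)
  fix n :: nat and \<epsilon> t :: real and R :: "nat set" and r :: nat
  assume *: "0 < \<epsilon> \<and> \<epsilon> \<le> 1 / exp 1 \<and> 1 \<le> t \<and> R \<subseteq> {..<n} \<and> card R = r \<and> 1 \<le> r \<and>
       real r \<le> \<epsilon> * exp (sqrt (ln (real n)) / 7)"
  interpret parameters n \<epsilon> t R r by unfold_locales (use * in auto)
  show "(\<forall>\<mu> :: nat \<Rightarrow> real set \<Rightarrow> real. (\<forall>p<n. value_function (\<mu> p)) \<longrightarrow>
          measure_pmf.prob (run_two_part \<mu> (divide_cake n \<epsilon> t R))
            {(X, q, Y, q').
               preassigned_fairly n R \<mu> X \<and>
               real q \<le> 5000000 * (t * real r ^ 2 / \<epsilon> * ln (real r / \<epsilon>) ^ 3) \<and>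
               completed_fairly n R \<epsilon> \<mu> Y \<and>
               real q' \<le> 11 * (real r * real n * ln (real r * real n)) \<and>
               disjoint_portions n R X Y}
          \<ge> 1 - (\<epsilon> / real r) powr t) \<and>
       1 - (\<epsilon> / real r) powr t \<ge> 1 - exp (- t)"
    using divide_cake_correct error_le by auto
qed

end
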